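(* Let $\{X_i(t): i\in\mathbb{Z}^d, t\in\mathbb{R}\}$ be the minimal stationary process of the interference queueing dynamics on $\mathbb{Z}^d$ with arrival intensity $\lambda$ and interference sequence $(a_j)_{j\in\mathbb{Z}^d}$ (see context). For every $0<\lambda<\frac{1}{\sum_{j\in\mathbb{Z}^d}a_j}$ there exist positive constants $C_1,C_2$ such that for any $t\in\mathbb{R}$, $$\lim_{N\to\infty}\mathbb{P}\left(C_1\log N\le\max_{i\in\mathbb{Z}^d:\ \|i\|_\infty\le N}X_i(t)\le C_2\log N\right)=1.$$
   Context: Model. Fix $d\ge1$ and a sequence $(a_i)_{i\in\mathbb{Z}^d}$ (the interference sequence) with $a_i\ge0$, $a_i=a_{-i}$ for all $i$, $a_0=1$ and $\sum_{i\in\mathbb{Z}^d}a_i<\infty$ (infinitely many $a_i$ may be nonzero). Convention: $0/0=0$. $\mathbb{N}_0=\{0,1,2,\dots\}$. Let $\{\mathcal{A}_i\}_{i\in\mathbb{Z}^d}$ be independent Poisson point processes on $\mathbb{R}$ with intensity $\lambda$, and, independently, let $\{\mathcal{D}_i\}_{i\in\mathbb{Z}^d}$ be independent Poisson point processes of unit intensity on $\mathbb{R}\times[0,1]$. There is a queue at each $i\in\mathbb{Z}^d$, with queue length $X_i(t)\in\mathbb{N}_0$ at time $t$. An arrival ($X_i$ increases by 1) occurs at queue $i$ at each epoch of $\mathcal{A}_i$. At each atom $(t,u)$ of $\mathcal{D}_i$, a departure ($X_i$ decreases by 1) occurs from queue $i$ at time $t$ if and only if $u\le \frac{X_i(t)}{\sum_{j\in\mathbb{Z}^d}a_jX_{i-j}(t)}$,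 with queue lengths evaluated just before $t$. Thus, given the configuration, queue $i$ has departures at rate $\frac{X_i(t)}{\sum_{j}a_jX_{i-j}(t)}$. It is known that this process is well defined path-wise from the driving processes and is monotone: with the same driving processes, coordinate-wise ordered initial configurations remain coordinate-wise ordered for all later times. Minimal stationary process (Coupling-From-The-Past). For $t\ge0$ and $s\ge-t$ let $X_{i;t}(s)$ be the length of queue $i$ at time $s$ when the dynamics is started at time $-t$ with all queues empty, all these processes being built from the same $(\mathcal{A}_i,\mathcal{D}_i)_{i\in\mathbb{Z}^d}$. By monotonicity $t\mapsto X_{i;t}(s)$ is non-decreasing almost surely; set $X_{i;\infty}(s):=\lim_{t\to\infty}X_{i;t}(s)$. It is known that if $\lambda<1/\sum_{j}a_j$, then $\{X_{i;\infty}(s)\}$ is a (finite, translation invariant) stationary solution of the dynamics, and it is minimal: any other stationary solution stochastically dominates it coordinate-wise. The minimal stationary process is $X_i(t):=X_{i;\infty}(t)$, $i\in\mathbb{Z}^d$, $t\in\mathbb{R}$. *)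

theory Defs
  imports "HOL-Probability.Probability"
begin

section \<open>Poisson point processes\<close>

text \<open>
  A realisation of a point process on \<open>E\<close> is a locally finite subset of \<open>E\<close>. Multiplicities are not
  needed: all intensity measures used below are diffuse, so that the processes are simple.
\<close>

definition locally_finite :: "'a::metric_space set \<Rightarrow> bool" where
  "locally_finite S \<longleftrightarrow> (\<forall>B. bounded B \<longrightarrow> finite (S \<inter> B))"

text \<open>The \<open>\<sigma>\<close>-algebra on configurations is generated by the numbers of points in bounded Borel sets.\<close>

definition config_space :: "'a::metric_space set \<Rightarrow> 'a set measure" where
  "config_space E = sigma {S. S \<subseteq> E \<and> locally_finite S}
     {{S. S \<subseteq> E \<and> locally_finite S \<and> card (S \<inter> B) = n} | B n. B \<in> sets borel \<and> bounded B}"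

text \<open>
  \<open>\<Phi>\<close> is a Poisson point process on \<open>space \<mu>\<close> with intensity measure \<open>\<mu>\<close>, where \<open>\<mu>\<close> is finite on
  bounded sets. Since \<open>B k = {}\<close> is allowed, independence over infinite disjoint sequences covers
  finite families of disjoint sets.
\<close>

definition poisson_process ::
    "'w measure \<Rightarrow> 'a::metric_space measure \<Rightarrow> ('w \<Rightarrow> 'a set) \<Rightarrow> bool" where
  "poisson_process M \<mu> \<Phi> \<longleftrightarrow>
     \<Phi> \<in> measurable M (config_space (space \<mu>)) \<and>
     (\<forall>B\<in>sets \<mu>. bounded B \<longrightarrow>
        (\<forall>n. measure M {\<omega> \<in> space M. card (\<Phi> \<omega> \<inter> B) = n}
               = measure \<mu> B ^ n / fact n * exp (- measure \<mu> B))) \<and>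
     (\<forall>B::nat \<Rightarrow> 'a set. disjoint_family B \<and> (\<forall>k. B k \<in> sets \<mu> \<and> bounded (B k)) \<longrightarrow>
        prob_space.indep_vars M (\<lambda>_. count_space UNIV) (\<lambda>k \<omega>. card (\<Phi> \<omega> \<inter> B k)) UNIV)"


section \<open>The interference queueing dynamics\<close>

text \<open>Sites are the elements of \<open>int ^ 'd\<close>; the dimension \<open>CARD('d)\<close> is at least one.\<close>

definition linf_norm :: "int ^ 'd \<Rightarrow> int" where
  "linf_norm i = Max (range (\<lambda>k. \<bar>i $ k\<bar>))"

definition interference_sequence :: "(int ^ 'd \<Rightarrow> real) \<Rightarrow> bool" where
  "interference_sequence a \<longleftrightarrow>
     (\<forall>i. 0 \<le> a i) \<and> (\<forall>i. a (- i) = a i) \<and> a 0 = 1 \<and> a summable_on UNIV"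

text \<open>
  \<open>A i \<omega>\<close> is the set of arrival epochs at queue \<open>i\<close>, and \<open>D i \<omega>\<close> the set of atoms \<open>(r, u)\<close> of the
  potential departures from queue \<open>i\<close>.
\<close>

definition driving_processes ::
    "'w measure \<Rightarrow> real \<Rightarrow> (int ^ 'd \<Rightarrow> 'w \<Rightarrow> real set) \<Rightarrow>
     (int ^ 'd \<Rightarrow> 'w \<Rightarrow> (real \<times> real) set) \<Rightarrow> bool" where
  "driving_processes M lam A D \<longleftrightarrow>
     prob_space M \<and>
     (\<forall>i. poisson_process M (scale_measure (ennreal lam) lborel) (A i)) \<and>
     (\<forall>i. poisson_process M (restrict_space lborel (UNIV \<times> {0..1})) (D i)) \<and>
     prob_space.indep_vars M (\<lambda>_. config_space UNIV) A UNIV \<and>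
     prob_space.indep_vars M (\<lambda>_. config_space (UNIV \<times> {0..1})) D UNIV \<and>
     prob_space.indep_set M
       (sets (vimage_algebra (space M) (\<lambda>\<omega> i. A i \<omega>) (PiM UNIV (\<lambda>_. config_space UNIV))))
       (sets (vimage_algebra (space M) (\<lambda>\<omega> i. D i \<omega>) (PiM UNIV (\<lambda>_. config_space (UNIV \<times> {0..1})))))"

text \<open>
  The departure rate of queue \<open>i\<close> in configuration \<open>x\<close>. Both \<open>0 / 0 = 0\<close> and, if the interference
  sum diverges, the value \<open>0\<close> (i.e. \<open>x i / \<infinity>\<close>) come out of the library conventions, because \<open>infsum\<close>
  is \<open>0\<close> for a non-summable family.
\<close>

definition departure_rate :: "(int ^ 'd \<Rightarrow> real) \<Rightarrow> (int ^ 'd \<Rightarrow> nat) \<Rightarrow> int ^ 'd \<Rightarrow> real" where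
  "departure_rate a x i = real (x i) / (\<Sum>\<^sub>\<infinity>j. a j * real (x (i - j)))"

text \<open>
  \<open>x i s\<close> (for \<open>s \<ge> s0\<close>) is a path of queue lengths, with all queues empty at time \<open>s0\<close>, that is driven
  by the arrival epochs \<open>\<alpha>\<close> and the potential departures \<open>\<delta>\<close>: every epoch of \<open>\<alpha> i\<close> adds a customer
  to queue \<open>i\<close>, and an atom \<open>(r, u)\<close> of \<open>\<delta> i\<close> removes one iff \<open>u\<close> is at most the departure rate
  immediately before \<open>r\<close>. The left limits exist since the equation makes each \<open>x k\<close> piecewise
  constant. Nothing is said about \<open>x\<close> before \<open>s0\<close>.
\<close>

definition queue_path_from_empty ::
    "(int ^ 'd \<Rightarrow> real) \<Rightarrow> (int ^ 'd \<Rightarrow> real set) \<Rightarrow> (int ^ 'd \<Rightarrow> (real \<times> real) set) \<Rightarrow>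
     real \<Rightarrow> (int ^ 'd \<Rightarrow> real \<Rightarrow> nat) \<Rightarrow> bool" where
  "queue_path_from_empty a \<alpha> \<delta> s0 x \<longleftrightarrow>
     (\<forall>i. \<forall>s\<ge>s0.
        int (x i s) = int (card {r \<in> \<alpha> i. s0 < r \<and> r \<le> s})
          - int (card {(r, u) \<in> \<delta> i. s0 < r \<and> r \<le> s \<and>
                         u \<le> departure_rate a (\<lambda>k. Lim (at_left r) (x k)) i}))"


section \<open>The minimal stationary process\<close>

text \<open>
  Coupling from the past: \<open>Y t i s\<close> is the length of queue \<open>i\<close> at time \<open>s \<ge> -t\<close> when the dynamics is
  started with all queues empty at time \<open>-t\<close>, and \<open>X i s\<close> is its limit as \<open>t \<rightarrow> \<infinity>\<close>. The limit is taken
  in the extended natural numbers, so finiteness of \<open>X\<close> is not presupposed. For each \<open>t\<close> the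
  solution \<open>Y t\<close> is almost surely unique (the dynamics is well defined path-wise), so that \<open>X i s\<close> is
  determined up to null sets by the driving processes.
\<close>

definition minimal_stationary_process ::
    "'w measure \<Rightarrow> (int ^ 'd \<Rightarrow> real) \<Rightarrow> (int ^ 'd \<Rightarrow> 'w \<Rightarrow> real set) \<Rightarrow>
     (int ^ 'd \<Rightarrow> 'w \<Rightarrow> (real \<times> real) set) \<Rightarrow> (int ^ 'd \<Rightarrow> real \<Rightarrow> 'w \<Rightarrow> enat) \<Rightarrow> bool" where
  "minimal_stationary_process M a A D X \<longleftrightarrow>
     (\<exists>Y :: real \<Rightarrow> int ^ 'd \<Rightarrow> real \<Rightarrow> 'w \<Rightarrow> nat.
        (\<forall>t\<ge>0. \<forall>i. \<forall>s\<ge>-t. Y t i s \<in> measurable M (count_space UNIV)) \<and>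
        (\<forall>t\<ge>0. AE \<omega> in M.
           queue_path_from_empty a (\<lambda>i. A i \<omega>) (\<lambda>i. D i \<omega>) (- t) (\<lambda>i s. Y t i s \<omega>)) \<and>
        (\<forall>i s. X i s \<in> measurable M (count_space UNIV)) \<and>
        (\<forall>i s. AE \<omega> in M. ((\<lambda>t. enat (Y t i s \<omega>)) \<longlongrightarrow> X i s \<omega>) at_top))"

end

theory Submission
  imports Defs
begin

text \<open>
  Upper bound. Fix a small step \<open>h\<close>. A queue system with discrete time dominates every solution started
  from the empty configuration: in each step at most one customer departs from \<open>i\<close>, namely
  if the least mark in the step does not exceed \<open>Z i / S i\<close>, where \<open>Z\<close> is the configuration at the
  beginning of the step and \<open>S i\<close> the interference at \<open>i\<close> including all arrivals at other sites
  during the step. The arrival counts and least marks are independent, so \<open>Z\<close> is a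
  countable Markov system, and for \<open>lam * (\<Sum>a) < 1\<close> and small \<open>h\<close>, \<open>\<theta>\<close> the moment of \<open>Z i * exp (\<theta> * Z i)\<close> contracts in
  each step up to lower-order terms. Hence it is bounded uniformly in the site and the number of steps,
  and queue lengths have exponential tails; a union bound concludes.

  Lower bound. Independently over the sites, with probability at least \<open>exp (- k * (1 + 1 / lam))\<close> there
  are \<open>k\<close> arrivals and no potential departures during the last \<open>k / lam\<close> units of time.
\<close>

section \<open>Independence and Poisson variables\<close>

text \<open>When the range of interference is infinite, no finite set of queues decouples from the
  others, and a drift computation for the continuous-time queues would need finite moments in
  advance. The dominating system is an explicit recursion in independent variables started from
  zero, so its moments can be propagated one step at a time. Allowing one departure per step costs
  only second order in the step \<open>h\<close>: a mark at most \<open>u\<close> appears with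
  probability 1 - exp (- h * u), which is at least \<kappa> * u for \<open>u\<close> in [0, 1] with
  \<kappa> = h - h^2 / 2. Counting foreign arrivals from the start of the step only adds a
  lower-order moment. The rate z / s is convex in \<open>s\<close>, and its tangent at s = \<alpha>
  * z, the load produced by equal queues, has value 1 / \<alpha> there. Hence nothing of the
  stability condition is lost. The weight x * exp (\<theta> * x) fits this tangent: multiplied by
  it, the term linear in \<open>s\<close> carries only exp (\<theta> * z), so each cross term with
  another queue is again of the order of the weight, with leading coefficient one.\<close>

context prob_space
begin

text \<open>Group a finite intersection by the first index: each inner intersection lies in
  \<open>F j\<close> by stability, so outer independence splits the groups and inner independence
  splits each group. It serves twice, for arrivals against departures over the sites and for the
  sites over the time windows.\<close>

lemma indep_sets_SIGMA:
  assumes F: "indep_sets F J"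
    and G: "\<And>j. j \<in> J \<Longrightarrow> indep_sets (G j) (L j)"
    and sub: "\<And>j l. j \<in> J \<Longrightarrow> l \<in> L j \<Longrightarrow> G j l \<subseteq> F j"
    and Int: "\<And>j. j \<in> J \<Longrightarrow> Int_stable (F j)"
  shows "indep_sets (\<lambda>(j, l). G j l) (Sigma J L)"
proof (rule indep_setsI)
  fix p assume "p \<in> Sigma J L"
  then show "(case p of (j, l) \<Rightarrow> G j l) \<subseteq> events"
    using F sub unfolding indep_sets_def by blast
next
  fix E K
  assume K: "K \<noteq> {}" "K \<subseteq> Sigma J L" "finite K"
    and E: "\<forall>p\<in>K. E p \<in> (case p of (j, l) \<Rightarrow> G j l)"
  define K' where "K' j = {l. (j, l) \<in> K}" for j
  have finK': "finite (K' j)" for j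
    unfolding K'_def by (rule finite_subset[OF _ finite_imageI[OF K(3), of snd]]) force
  have K'ne: "K' j \<noteq> {}" if "j \<in> fst ` K" for j
    using that unfolding K'_def by force
  have subJ: "fst ` K \<subseteq> J" and subL: "\<And>j. K' j \<subseteq> L j"
    using K(2) unfolding K'_def by auto
  have E': "E (j, l) \<in> G j l" if "l \<in> K' j" for j l
    using E that unfolding K'_def by auto
  have KS: "K = Sigma (fst ` K) K'"
    unfolding K'_def by force
  have IntF: "(\<Inter>l\<in>K' j. E (j, l)) \<in> F j" if j: "j \<in> fst ` K" for j
  proof -
    have jJ: "j \<in> J" using subJ j by auto
    have "finite T \<Longrightarrow> T \<noteq> {} \<Longrightarrow> T \<subseteq> K' j \<Longrightarrow> (\<Inter>l\<in>T. E (j, l)) \<in> F j" for T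
    proof (induction T rule: finite_ne_induct)
      case (singleton l)
      then show ?case using E'[of l j] sub[OF jJ] subL[of j] by auto
    next
      case (insert l T)
      have "E (j, l) \<in> F j" using E'[of l j] sub[OF jJ] subL[of j] insert by auto
      then show ?case using insert Int[OF jJ] by (auto simp: Int_stable_def)
    qed
    then show ?thesis using finK' K'ne[OF j] by blast
  qed
  have "(\<Inter>p\<in>K. E p) = (\<Inter>j\<in>fst ` K. \<Inter>l\<in>K' j. E (j, l))"
    by (subst KS) auto
  then have "prob (\<Inter>p\<in>K. E p) = prob (\<Inter>j\<in>fst ` K. \<Inter>l\<in>K' j. E (j, l))" by simp
  also have "\<dots> = (\<Prod>j\<in>fst ` K. prob (\<Inter>l\<in>K' j. E (j, l)))"
    using IntF K by (intro indep_setsD[OF F subJ]) auto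
  also have "\<dots> = (\<Prod>j\<in>fst ` K. \<Prod>l\<in>K' j. prob (E (j, l)))"
    using subJ subL K'ne finK' E' by (intro prod.cong refl indep_setsD[OF G]) auto
  also have "\<dots> = (\<Prod>p\<in>Sigma (fst ` K) K'. prob (E p))"
    using K finK' by (subst prod.Sigma) (auto simp: case_prod_unfold)
  also have "\<dots> = (\<Prod>p\<in>K. prob (E p))" using KS by simp
  finally show "prob (\<Inter>p\<in>K. E p) = (\<Prod>p\<in>K. prob (E p))" .
qed

lemma indep_var_disjoint_coordinates:
  fixes G :: "'i \<Rightarrow> 'a \<Rightarrow> real"
  assumes G: "indep_vars (\<lambda>_. borel) G UNIV"
    and F1[measurable]: "F1 \<in> measurable (PiM UNIV (\<lambda>_. borel)) N1"
    and F2[measurable]: "F2 \<in> measurable (PiM UNIV (\<lambda>_. borel)) N2"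
    and K: "K1 \<inter> K2 = {}"
    and dep1: "\<And>g g'. (\<And>i. i \<in> K1 \<Longrightarrow> g i = g' i) \<Longrightarrow> F1 g = F1 g'"
    and dep2: "\<And>g g'. (\<And>i. i \<in> K2 \<Longrightarrow> g i = g' i) \<Longrightarrow> F2 g = F2 g'"
  shows "indep_var N1 (\<lambda>\<omega>. F1 (\<lambda>i. G i \<omega>)) N2 (\<lambda>\<omega>. F2 (\<lambda>i. G i \<omega>))"
proof -
  \<comment> \<open>Independence is available for the restrictions to \<open>K1\<close> and
    \<open>K2\<close>, but the functionals live on the full product. Filling the missing coordinates
    with 0 does not change their values, by \<open>dep1\<close> and \<open>dep2\<close>.\<close>
  define ext where "ext S = (\<lambda>(g :: 'i \<Rightarrow> real) i. if i \<in> S then g i else 0)" for S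
  have ext[measurable]: "ext S \<in> measurable (PiM S (\<lambda>_. borel)) (PiM UNIV (\<lambda>_. borel))" for S
    unfolding ext_def
  proof (rule measurable_PiM_single')
    fix i
    show "(\<lambda>g. if i \<in> S then g i else 0) \<in> borel_measurable (PiM S (\<lambda>_. borel))"
      by (cases "i \<in> S") auto
  qed auto
  have "indep_var N1 ((F1 \<circ> ext K1) \<circ> (\<lambda>\<omega>. restrict (\<lambda>i. G i \<omega>) K1))
          N2 ((F2 \<circ> ext K2) \<circ> (\<lambda>\<omega>. restrict (\<lambda>i. G i \<omega>) K2))"
    by (rule indep_var_compose[OF indep_var_restrict[OF G K]]) auto
  also have "(F1 \<circ> ext K1) \<circ> (\<lambda>\<omega>. restrict (\<lambda>i. G i \<omega>) K1) = (\<lambda>\<omega>. F1 (\<lambda>i. G i \<omega>))"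
    by (auto simp: ext_def fun_eq_iff intro!: dep1)
  also have "(F2 \<circ> ext K2) \<circ> (\<lambda>\<omega>. restrict (\<lambda>i. G i \<omega>) K2) = (\<lambda>\<omega>. F2 (\<lambda>i. G i \<omega>))"
    by (auto simp: ext_def fun_eq_iff intro!: dep2)
  finally show ?thesis .
qed

lemma nn_integral_indep_var:
  assumes ind: "indep_var S X T Y"
    and g[measurable]: "case_prod g \<in> borel_measurable (S \<Otimes>\<^sub>M T)"
  shows "(\<integral>\<^sup>+\<omega>. g (X \<omega>) (Y \<omega>) \<partial>M) = (\<integral>\<^sup>+\<omega>. \<integral>\<^sup>+\<omega>'. g (X \<omega>) (Y \<omega>') \<partial>M \<partial>M)"
proof -
  have X[measurable]: "X \<in> measurable M S" and Y[measurable]: "Y \<in> measurable M T"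
    and eq: "distr M S X \<Otimes>\<^sub>M distr M T Y = distr M (S \<Otimes>\<^sub>M T) (\<lambda>x. (X x, Y x))"
    using ind by (auto simp: indep_var_distribution_eq)
  interpret Y: prob_space "distr M T Y" by (rule prob_space_distr) fact
  interpret X: prob_space "distr M S X" by (rule prob_space_distr) fact
  interpret XY: pair_prob_space "distr M S X" "distr M T Y" ..
  have "(\<integral>\<^sup>+\<omega>. g (X \<omega>) (Y \<omega>) \<partial>M) = (\<integral>\<^sup>+p. case_prod g p \<partial>distr M (S \<Otimes>\<^sub>M T) (\<lambda>x. (X x, Y x)))"
    by (subst nn_integral_distr) auto
  also have "\<dots> = (\<integral>\<^sup>+p. case_prod g p \<partial>(distr M S X \<Otimes>\<^sub>M distr M T Y))"
    by (simp add: eq)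
  also have "\<dots> = (\<integral>\<^sup>+x. \<integral>\<^sup>+y. g x y \<partial>distr M T Y \<partial>distr M S X)"
    by (subst Y.nn_integral_fst[symmetric]) auto
  also have "\<dots> = (\<integral>\<^sup>+x. \<integral>\<^sup>+\<omega>'. g x (Y \<omega>') \<partial>M \<partial>distr M S X)"
    by (intro nn_integral_cong, subst nn_integral_distr) auto
  also have "\<dots> = (\<integral>\<^sup>+\<omega>. \<integral>\<^sup>+\<omega>'. g (X \<omega>) (Y \<omega>') \<partial>M \<partial>M)"
    by (subst nn_integral_distr) auto
  finally show ?thesis .
qed

text \<open>Plays the part of conditioning on the past: the functional of \<open>K1\<close> is
  frozen while that of \<open>K2\<close> is integrated over an independent copy.\<close>

lemma nn_integral_disjoint_coordinates:
  fixes G :: "'i \<Rightarrow> 'a \<Rightarrow> real"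
  assumes G: "indep_vars (\<lambda>_. borel) G UNIV"
    and F1[measurable]: "F1 \<in> measurable (PiM UNIV (\<lambda>_. borel)) N1"
    and F2[measurable]: "F2 \<in> measurable (PiM UNIV (\<lambda>_. borel)) N2"
    and K: "K1 \<inter> K2 = {}"
    and dep1: "\<And>g g'. (\<And>i. i \<in> K1 \<Longrightarrow> g i = g' i) \<Longrightarrow> F1 g = F1 g'"
    and dep2: "\<And>g g'. (\<And>i. i \<in> K2 \<Longrightarrow> g i = g' i) \<Longrightarrow> F2 g = F2 g'"
    and f[measurable]: "case_prod f \<in> borel_measurable (N1 \<Otimes>\<^sub>M N2)"
  shows "(\<integral>\<^sup>+\<omega>. f (F1 (\<lambda>i. G i \<omega>)) (F2 (\<lambda>i. G i \<omega>)) \<partial>M)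
    = (\<integral>\<^sup>+\<omega>. \<integral>\<^sup>+\<omega>'. f (F1 (\<lambda>i. G i \<omega>)) (F2 (\<lambda>i. G i \<omega>')) \<partial>M \<partial>M)"
proof -
  let ?ext = "\<lambda>S (g :: 'i \<Rightarrow> real) i. if i \<in> S then g i else 0"
  have [measurable]: "?ext S \<in> measurable (PiM UNIV (\<lambda>_. borel)) (PiM UNIV (\<lambda>_. borel))" for S
  proof (rule measurable_PiM_single')
    fix i
    show "(\<lambda>g. if i \<in> S then g i else 0) \<in> borel_measurable (PiM UNIV (\<lambda>_. borel))"
      by (cases "i \<in> S") auto
  qed auto
  have "indep_var (PiM UNIV (\<lambda>_. borel)) (\<lambda>\<omega>. ?ext K1 (\<lambda>i. G i \<omega>))
      (PiM UNIV (\<lambda>_. borel)) (\<lambda>\<omega>. ?ext K2 (\<lambda>i. G i \<omega>))"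
    using K by (intro indep_var_disjoint_coordinates[OF G, of "?ext K1" _ "?ext K2" _ K1 K2]) (auto simp: fun_eq_iff)
  from nn_integral_indep_var[OF this, of "\<lambda>x y. f (F1 x) (F2 y)"]
  have "(\<integral>\<^sup>+\<omega>. f (F1 (?ext K1 (\<lambda>i. G i \<omega>))) (F2 (?ext K2 (\<lambda>i. G i \<omega>))) \<partial>M)
    = (\<integral>\<^sup>+\<omega>. \<integral>\<^sup>+\<omega>'. f (F1 (?ext K1 (\<lambda>i. G i \<omega>))) (F2 (?ext K2 (\<lambda>i. G i \<omega>'))) \<partial>M \<partial>M)"
    by simp
  moreover have "F1 (?ext K1 g) = F1 g" for g by (rule dep1) auto
  moreover have "F2 (?ext K2 g) = F2 g" for g by (rule dep2) auto
  ultimately show ?thesis by simp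
qed

end

section \<open>Exponential moments of Poisson variables\<close>

lemma poisson_exp_sums:
  fixes \<mu> \<theta> :: real
  shows "(\<lambda>n. exp (\<theta> * real n) * (\<mu> ^ n / fact n * exp (- \<mu>))) sums exp (\<mu> * (exp \<theta> - 1))"
proof -
  have "(\<lambda>n. (\<mu> * exp \<theta>) ^ n /\<^sub>R fact n * exp (- \<mu>)) sums (exp (\<mu> * exp \<theta>) * exp (- \<mu>))"
    by (intro sums_mult2 exp_converges)
  moreover have "exp (\<mu> * exp \<theta>) * exp (- \<mu>) = exp (\<mu> * (exp \<theta> - 1))"
    by (simp add: exp_add[symmetric] algebra_simps)
  moreover have "(\<mu> * exp \<theta>) ^ n /\<^sub>R fact n * exp (- \<mu>)
      = exp (\<theta> * real n) * (\<mu> ^ n / fact n * exp (- \<mu>))" for n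
    by (simp add: exp_of_nat2_mult power_mult_distrib field_simps)
  ultimately show ?thesis by simp
qed

text \<open>This is the \<theta>-derivative of the preceding moment. Since n / n! = 1 / (n - 1)! and
  the term at 0 vanishes, an index shift reduces it to that moment.\<close>

lemma poisson_mean_exp_sums:
  fixes \<mu> \<theta> :: real
  shows "(\<lambda>n. real n * exp (\<theta> * real n) * (\<mu> ^ n / fact n * exp (- \<mu>)))
           sums (\<mu> * exp \<theta> * exp (\<mu> * (exp \<theta> - 1)))"
proof -
  let ?f = "\<lambda>n. real n * exp (\<theta> * real n) * (\<mu> ^ n / fact n * exp (- \<mu>))"
  have eq: "?f (Suc n) = \<mu> * exp \<theta> * (exp (\<theta> * real n) * (\<mu> ^ n / fact n * exp (- \<mu>)))" for n
  proof -
    have 1: "exp (\<theta> * real (Suc n)) = exp \<theta> * exp (\<theta> * real n)"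
      by (simp add: exp_add distrib_left)
    have 2: "real (Suc n) * (\<mu> ^ Suc n / fact (Suc n)) = \<mu> * (\<mu> ^ n / fact n)"
      by (simp add: divide_simps)
    have "?f (Suc n) = (real (Suc n) * (\<mu> ^ Suc n / fact (Suc n))) * exp (\<theta> * real (Suc n)) * exp (- \<mu>)"
      by (simp only: ac_simps)
    also have "\<dots> = \<mu> * exp \<theta> * (exp (\<theta> * real n) * (\<mu> ^ n / fact n * exp (- \<mu>)))"
      unfolding 1 2 by (simp only: ac_simps)
    finally show ?thesis .
  qed
  have "(\<lambda>n. ?f (Suc n)) sums (\<mu> * exp \<theta> * exp (\<mu> * (exp \<theta> - 1)))"
    unfolding eq by (rule sums_mult[OF poisson_exp_sums])
  then show ?thesis by (rule sums_Suc_imp[rotated]) simp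
qed

locale poisson_variable = prob_space +
  fixes N :: "'a \<Rightarrow> nat" and \<mu> :: real
  assumes N_measurable[measurable]: "N \<in> measurable M (count_space UNIV)"
    and \<mu>_nonneg: "0 \<le> \<mu>"
    and N_distr: "prob {\<omega> \<in> space M. N \<omega> = n} = \<mu> ^ n / fact n * exp (- \<mu>)"
begin

lemma has_expectation_sums:
  fixes f :: "nat \<Rightarrow> real"
  assumes f: "\<And>n. 0 \<le> f n" and s: "(\<lambda>n. f n * (\<mu> ^ n / fact n * exp (- \<mu>))) sums s"
  shows "integrable M (\<lambda>\<omega>. f (N \<omega>))" "expectation (\<lambda>\<omega>. f (N \<omega>)) = s"
proof -
  have nn: "0 \<le> f n * (\<mu> ^ n / fact n * exp (- \<mu>))" for n
    using f \<mu>_nonneg by simp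
  have s0: "0 \<le> s" using sums_le[OF _ sums_zero s] nn by auto
  have "(\<integral>\<^sup>+\<omega>. ennreal (f (N \<omega>)) \<partial>M) = (\<integral>\<^sup>+n. ennreal (f n) \<partial>distr M (count_space UNIV) N)"
    by (subst nn_integral_distr) auto
  also have "distr M (count_space UNIV) N
      = density (count_space UNIV) (\<lambda>n. ennreal (\<mu> ^ n / fact n * exp (- \<mu>)))"
  proof (rule measure_eqI_countable[where A=UNIV])
    fix n :: nat
    show "emeasure (distr M (count_space UNIV) N) {n}
        = emeasure (density (count_space UNIV) (\<lambda>n. ennreal (\<mu> ^ n / fact n * exp (- \<mu>)))) {n}"
      using N_distr[of n]
      by (subst emeasure_distr) (auto simp: emeasure_eq_measure vimage_def Int_def emeasure_density
          nn_integral_count_space_indicator[symmetric] conj_commute)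
  qed auto
  also have "(\<integral>\<^sup>+n. ennreal (f n) \<partial>\<dots>) = (\<Sum>n. ennreal (f n * (\<mu> ^ n / fact n * exp (- \<mu>))))"
    using f \<mu>_nonneg
    by (subst nn_integral_density)
       (auto simp: nn_integral_count_space_nat ennreal_mult[symmetric] mult.commute)
  also have "\<dots> = ennreal s"
    using s nn by (intro suminf_ennreal_eq)
  finally have nni: "(\<integral>\<^sup>+\<omega>. ennreal (f (N \<omega>)) \<partial>M) = ennreal s" .
  show "integrable M (\<lambda>\<omega>. f (N \<omega>))"
    by (rule integrableI_nn_integral_finite[OF _ _ nni]) (use f s0 in auto)
  show "expectation (\<lambda>\<omega>. f (N \<omega>)) = s"
    by (subst integral_eq_nn_integral) (use f s0 nni in auto)
qed

lemmas exp_moment = has_expectation_sums[OF _ poisson_exp_sums, simplified]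
lemmas mean_exp_moment = has_expectation_sums[OF _ poisson_mean_exp_sums, simplified]

end

section \<open>The dominating discrete-time system\<close>

text \<open>Valued in \<open>ennreal\<close> because finiteness is a result and not known
  beforehand. The arrivals at \<open>i\<close> itself are left out (\<open>j = 0\<close>), so that
  the thinned queue at \<open>i\<close> stays independent of them.\<close>

definition load :: "(int ^ 'd \<Rightarrow> real) \<Rightarrow> (int ^ 'd \<Rightarrow> nat) \<Rightarrow> (int ^ 'd \<Rightarrow> nat) \<Rightarrow> int ^ 'd \<Rightarrow> ennreal" where
  "load a z n i =
     (\<integral>\<^sup>+j. ennreal (a j * real (z (i - j) + (if j = 0 then 0 else n (i - j)))) \<partial>count_space UNIV)"

text \<open>
  One time step of the dominating system with \<open>n\<close> arrivals and least marks \<open>u\<close>, before the arrivals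
  at \<open>i\<close> are added. All arrivals at the other sites count as interference already from the start of
  the step, and at most one departure is allowed: it occurs if even the queue length \<open>z i\<close> would have
  accepted the mark \<open>u i\<close>. If the load is infinite, \<open>enn2real\<close> makes it \<open>0\<close> and a departure may occur;
  this happens with probability zero only.
\<close>

definition thinned :: "(int ^ 'd \<Rightarrow> real) \<Rightarrow> (int ^ 'd \<Rightarrow> nat) \<Rightarrow> (int ^ 'd \<Rightarrow> nat) \<Rightarrow>
    (int ^ 'd \<Rightarrow> real) \<Rightarrow> int ^ 'd \<Rightarrow> nat" where
  "thinned a z n u i =
     (if 1 \<le> z i \<and> u i * enn2real (load a z n i) \<le> real (z i) then z i - 1 else z i)"

primrec dominating :: "(int ^ 'd \<Rightarrow> real) \<Rightarrow> (nat \<Rightarrow> int ^ 'd \<Rightarrow> nat) \<Rightarrow>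
    (nat \<Rightarrow> int ^ 'd \<Rightarrow> real) \<Rightarrow> nat \<Rightarrow> int ^ 'd \<Rightarrow> nat" where
  "dominating a n u 0 = (\<lambda>_. 0)"
| "dominating a n u (Suc k) = (\<lambda>i. thinned a (dominating a n u k) (n k) (u k) i + n k i)"

lemma load_cong:
  assumes "\<And>j. z j = z' j" "\<And>j. j \<noteq> i \<Longrightarrow> n j = n' j"
  shows "load a z n i = load a z' n' i"
  unfolding load_def using assms by (intro nn_integral_cong) (auto simp: algebra_simps)

lemma dominating_cong:
  assumes "\<And>k' j. k' < k \<Longrightarrow> n k' j = n' k' j" "\<And>k' j. k' < k \<Longrightarrow> u k' j = u' k' j"
  shows "dominating a n u k = dominating a n' u' k"
  using assms
proof (induction k)
  case (Suc k)
  have "n k = n' k" "u k = u' k" using Suc.prems by auto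
  moreover have "dominating a n u k = dominating a n' u' k" using Suc by simp
  ultimately show ?case by simp
qed simp

lemma load_measurable:
  assumes [measurable]: "\<And>j. (\<lambda>x. z x j) \<in> measurable M (count_space UNIV)"
    "\<And>j. (\<lambda>x. n x j) \<in> measurable M (count_space UNIV)"
  shows "(\<lambda>x. load a (z x) (n x) i) \<in> borel_measurable M"
proof -
  interpret sigma_finite_measure "count_space (UNIV :: (int ^ 'd) set)"
    by (rule sigma_finite_measure_count_space_countable) auto
  have "(\<lambda>p. ennreal (a (snd p) * real (z (fst p) (i - snd p)
      + (if snd p = 0 then 0 else n (fst p) (i - snd p))))) \<in> borel_measurable (M \<Otimes>\<^sub>M count_space UNIV)"
    by (rule measurable_compose_countable'[where f="\<lambda>j p. ennreal (a j * real (z (fst p) (i - j)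
        + (if j = 0 then 0 else n (fst p) (i - j))))" and g=snd and I=UNIV]) auto
  then show ?thesis
    unfolding load_def by (intro borel_measurable_nn_integral) (simp add: case_prod_unfold)
qed

lemma thinned_measurable:
  assumes [measurable]: "\<And>j. (\<lambda>x. z x j) \<in> measurable M (count_space UNIV)"
    "\<And>j. (\<lambda>x. n x j) \<in> measurable M (count_space UNIV)"
    "(\<lambda>x. u x i) \<in> borel_measurable M"
  shows "(\<lambda>x. thinned a (z x) (n x) (u x) i) \<in> measurable M (count_space UNIV)"
proof -
  have [measurable]: "(\<lambda>x. load a (z x) (n x) i) \<in> borel_measurable M"
    by (rule load_measurable) auto
  show ?thesis unfolding thinned_def by measurable
qed

lemma dominating_measurable:
  assumes [measurable]: "\<And>k j. (\<lambda>x. n x k j) \<in> measurable M (count_space UNIV)"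
    "\<And>k j. (\<lambda>x. u x k j) \<in> borel_measurable M"
  shows "(\<lambda>x. dominating a (n x) (u x) k i) \<in> measurable M (count_space UNIV)"
proof (induction k arbitrary: i)
  case (Suc k)
  have [measurable]: "(\<lambda>x. thinned a (dominating a (n x) (u x) k) (n x k) (u x k) i)
      \<in> measurable M (count_space UNIV)"
    by (rule thinned_measurable[OF Suc]) auto
  show ?case by simp
qed simp

text \<open>The tangent line of \<open>y \<mapsto> exp (\<theta> * y)\<close> at \<open>x\<close>.\<close>

lemma exp_mult_young:
  fixes \<theta> x y :: real
  assumes "0 < \<theta>"
  shows "exp (\<theta> * x) * y \<le> x * exp (\<theta> * x) + exp (\<theta> * y) / \<theta>"
proof -
  have "1 + \<theta> * (y - x) \<le> exp (\<theta> * (y - x))" by (rule exp_ge_add_one_self)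
  then have "exp (\<theta> * x) * (1 + \<theta> * (y - x)) \<le> exp (\<theta> * x) * exp (\<theta> * (y - x))"
    by (intro mult_left_mono) auto
  also have "\<dots> = exp (\<theta> * y)" by (simp add: exp_add[symmetric] algebra_simps)
  finally have "\<theta> * (exp (\<theta> * x) * (y - x)) + exp (\<theta> * x) \<le> exp (\<theta> * y)"
    by (simp add: distrib_left mult.left_commute)
  then have "\<theta> * (exp (\<theta> * x) * (y - x)) \<le> exp (\<theta> * y)"
    using exp_ge_zero[of "\<theta> * x"] by linarith
  then have "exp (\<theta> * x) * (y - x) \<le> exp (\<theta> * y) / \<theta>"
    using assms by (simp add: pos_le_divide_eq mult.commute)
  then show ?thesis by (simp add: algebra_simps)
qed

text \<open>Point processes have disappeared here: only one countable independent family of counts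
  and marks remains. The linear bound \<open>U_lower\<close> is all that is kept of the law of the
  marks.\<close>

locale thinned_queues = prob_space M for M :: "'w measure" +
  fixes a :: "int ^ 'd \<Rightarrow> real" and N :: "nat \<Rightarrow> int ^ 'd \<Rightarrow> 'w \<Rightarrow> nat"
    and U :: "nat \<Rightarrow> int ^ 'd \<Rightarrow> 'w \<Rightarrow> real" and \<alpha> \<mu> \<kappa> :: real
  assumes a_nonneg: "\<And>j. 0 \<le> a j" and a_0: "a 0 = 1"
    and a_sum: "(\<integral>\<^sup>+j. ennreal (a j) \<partial>count_space UNIV) = ennreal \<alpha>" and \<alpha>_pos: "0 < \<alpha>"
    and indep: "indep_vars (\<lambda>_. borel) (\<lambda>((b, i), k) \<omega>. if b then real (N k i \<omega>) else U k i \<omega>) UNIV"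
    and \<mu>: "0 \<le> \<mu>" and N_poisson: "\<And>k i. poisson_variable M (N k i) \<mu>"
    and \<kappa>: "0 \<le> \<kappa>"
    and U_lower: "\<And>k i u. 0 \<le> u \<Longrightarrow> u \<le> 1 \<Longrightarrow> \<kappa> * u \<le> prob {\<omega> \<in> space M. U k i \<omega> \<le> u}"
begin

abbreviation "G \<equiv> \<lambda>((b, i), k) \<omega>. if b then real (N k i \<omega>) else U k i \<omega>"
definition "Z k i \<omega> = dominating a (\<lambda>k i. N k i \<omega>) (\<lambda>k i. U k i \<omega>) k i"
definition "S k i \<omega> = load a (\<lambda>i. Z k i \<omega>) (\<lambda>i. N k i \<omega>) i"
definition "W k i \<omega> = thinned a (\<lambda>i. Z k i \<omega>) (\<lambda>i. N k i \<omega>) (\<lambda>i. U k i \<omega>) i"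

lemma Z_0: "Z 0 i \<omega> = 0"
  by (simp add: Z_def)

lemma Z_Suc: "Z (Suc k) i \<omega> = W k i \<omega> + N k i \<omega>"
  by (simp add: Z_def W_def)

lemma N_measurable[measurable]: "N k i \<in> measurable M (count_space UNIV)"
proof -
  interpret poisson_variable M "N k i" \<mu> by (rule N_poisson)
  show ?thesis by (rule N_measurable)
qed

lemma U_measurable[measurable]: "U k i \<in> borel_measurable M"
  using indep unfolding indep_vars_def2 by (auto dest!: spec[of _ False] spec[of _ i] spec[of _ k])

lemma Z_measurable[measurable]: "Z k i \<in> measurable M (count_space UNIV)"
  unfolding Z_def by (rule dominating_measurable) auto

lemma S_measurable[measurable]: "S k i \<in> borel_measurable M"
  unfolding S_def by (rule load_measurable) auto

lemma W_measurable[measurable]: "W k i \<in> measurable M (count_space UNIV)"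
  unfolding W_def by (rule thinned_measurable) auto

text \<open>The system as a functional of real coordinates, where \<open>nat\<close> of the floor
  undoes the embedding \<open>real\<close> of the counts. Independence is then read off from the
  coordinates that a functional inspects.\<close>

abbreviation "n_of (g :: (bool \<times> (int ^ 'd)) \<times> nat \<Rightarrow> real) \<equiv> (\<lambda>k i. nat \<lfloor>g ((True, i), k)\<rfloor>)"
abbreviation "u_of (g :: (bool \<times> (int ^ 'd)) \<times> nat \<Rightarrow> real) \<equiv> (\<lambda>k i. g ((False, i), k))"
abbreviation "z_of g k i \<equiv> dominating a (n_of g) (u_of g) k i"
abbreviation "s_of g k i \<equiv> load a (z_of g k) (n_of g k) i"
abbreviation "w_of g k i \<equiv> thinned a (z_of g k) (n_of g k) (u_of g k) i"

lemma coordinate_measurable: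
  "(\<lambda>g. n_of g k i) \<in> measurable (PiM UNIV (\<lambda>_. borel)) (count_space UNIV)"
  "(\<lambda>g. u_of g k i) \<in> measurable (PiM UNIV (\<lambda>_. borel)) borel"
  by measurable

lemma z_of_measurable:
  "(\<lambda>g. z_of g k i) \<in> measurable (PiM UNIV (\<lambda>_. borel)) (count_space UNIV)"
  by (rule dominating_measurable[OF coordinate_measurable])

lemma s_of_measurable:
  "(\<lambda>g. s_of g k i) \<in> measurable (PiM UNIV (\<lambda>_. borel)) borel"
  by (rule load_measurable[OF z_of_measurable coordinate_measurable(1)])

lemma w_of_measurable:
  "(\<lambda>g. w_of g k i) \<in> measurable (PiM UNIV (\<lambda>_. borel)) (count_space UNIV)"
  by (rule thinned_measurable[OF z_of_measurable coordinate_measurable])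

text \<open>\<open>Z k\<close> inspects only steps before \<open>k\<close>, so every site
  \<open>j\<close> is allowed, including \<open>i\<close>.\<close>

lemma indep_Z_N: "indep_var (count_space UNIV) (Z k i) (count_space UNIV) (N k j)"
proof -
  have "z_of g k i = z_of g' k i" if "\<And>p. p \<in> {((b, j), k'). k' < k} \<Longrightarrow> g p = g' p" for g g'
    using that by (intro fun_cong[OF dominating_cong]) auto
  note dep = this
  have "indep_var (count_space UNIV) (\<lambda>\<omega>. z_of (\<lambda>p. G p \<omega>) k i)
      (count_space UNIV) (\<lambda>\<omega>. n_of (\<lambda>p. G p \<omega>) k j)"
  proof (rule indep_var_disjoint_coordinates[OF indep, where ?K1.0 = "{((b, j), k'). k' < k}"
          and ?K2.0 = "{((True, j), k)}" and ?F1.0 = "\<lambda>g. z_of g k i" and ?F2.0 = "\<lambda>g. n_of g k j"])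
    show "z_of g k i = z_of g' k i" if "\<And>p. p \<in> {((b, j), k'). k' < k} \<Longrightarrow> g p = g' p" for g g'
      using that by (rule dep)
    show "n_of g k j = n_of g' k j" if "\<And>p. p \<in> {((True, j), k)} \<Longrightarrow> g p = g' p" for g g'
      using that by simp
  qed ((fact z_of_measurable coordinate_measurable)+, auto)
  then show ?thesis by (simp add: Z_def[abs_def] S_def[abs_def] W_def[abs_def])
qed

text \<open>The pair of \<open>Z k i\<close> and \<open>S k i\<close> inspects arrivals of step
  \<open>k\<close> but none of its marks; hence the mark can be averaged with queue and load held
  fixed.\<close>

lemma nn_integral_ZS_U:
  assumes f[measurable]: "case_prod f \<in> borel_measurable ((count_space UNIV \<Otimes>\<^sub>M borel) \<Otimes>\<^sub>M borel)"
  shows "(\<integral>\<^sup>+\<omega>. f (Z k i \<omega>, S k i \<omega>) (U k i \<omega>) \<partial>M)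
    = (\<integral>\<^sup>+\<omega>. \<integral>\<^sup>+\<omega>'. f (Z k i \<omega>, S k i \<omega>) (U k i \<omega>') \<partial>M \<partial>M)"
proof -
  have "z_of g k = z_of g' k \<and> s_of g k i = s_of g' k i"
    if "\<And>p. p \<in> {((b, j), k'). k' < k \<or> k' = k \<and> b} \<Longrightarrow> g p = g' p" for g g'
  proof
    show "z_of g k = z_of g' k" using that by (intro dominating_cong) auto
    then show "s_of g k i = s_of g' k i" using that by (intro load_cong) auto
  qed
  note dep = this
  have "(\<integral>\<^sup>+\<omega>. f (z_of (\<lambda>p. G p \<omega>) k i, s_of (\<lambda>p. G p \<omega>) k i) (u_of (\<lambda>p. G p \<omega>) k i) \<partial>M)
    = (\<integral>\<^sup>+\<omega>. \<integral>\<^sup>+\<omega>'. f (z_of (\<lambda>p. G p \<omega>) k i, s_of (\<lambda>p. G p \<omega>) k i) (u_of (\<lambda>p. G p \<omega>') k i) \<partial>M \<partial>M)"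
  proof (rule nn_integral_disjoint_coordinates[OF indep, where ?K2.0 = "{((False, i), k)}"
          and ?K1.0 = "{((b, j), k'). k' < k \<or> k' = k \<and> b}" and f = f
          and ?F1.0 = "\<lambda>g. (z_of g k i, s_of g k i)" and ?F2.0 = "\<lambda>g. u_of g k i"])
    show "(z_of g k i, s_of g k i) = (z_of g' k i, s_of g' k i)"
      if "\<And>p. p \<in> {((b, j), k'). k' < k \<or> k' = k \<and> b} \<Longrightarrow> g p = g' p" for g g'
    proof -
      have "z_of g k = z_of g' k \<and> s_of g k i = s_of g' k i" by (rule dep) (rule that)
      from conjunct1[OF this, THEN fun_cong, of i] conjunct2[OF this] show ?thesis by (simp only:)
    qed
    show "u_of g k i = u_of g' k i" if "\<And>p. p \<in> {((False, i), k)} \<Longrightarrow> g p = g' p" for g g'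
      using that by simp
    show "(\<lambda>g. (z_of g k i, s_of g k i)) \<in> measurable (PiM UNIV (\<lambda>_. borel)) (count_space UNIV \<Otimes>\<^sub>M borel)"
      by (rule measurable_Pair[OF z_of_measurable s_of_measurable])
  qed ((fact coordinate_measurable f)+, auto)
  then show ?thesis by (simp add: Z_def[abs_def] S_def[abs_def] W_def[abs_def])
qed

text \<open>Here the exception at \<open>j = 0\<close> in \<open>load\<close> pays off: of step
  \<open>k\<close>, \<open>W k i\<close> inspects the marks and the arrivals at other sites
  only.\<close>

lemma indep_W_N: "indep_var (count_space UNIV) (W k i) (count_space UNIV) (N k i)"
proof -
  have "w_of g k i = w_of g' k i"
    if eq: "\<And>p. p \<in> {((b, j), k'). k' < k \<or> k' = k \<and> (\<not> b \<or> j \<noteq> i)} \<Longrightarrow> g p = g' p" for g g'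
  proof -
    have z: "z_of g k = z_of g' k" using eq by (intro dominating_cong) auto
    then have "s_of g k i = s_of g' k i" using eq by (intro load_cong) auto
    then show ?thesis using z eq unfolding thinned_def by auto
  qed
  note dep = this
  have "indep_var (count_space UNIV) (\<lambda>\<omega>. w_of (\<lambda>p. G p \<omega>) k i)
      (count_space UNIV) (\<lambda>\<omega>. n_of (\<lambda>p. G p \<omega>) k i)"
  proof (rule indep_var_disjoint_coordinates[OF indep, where ?K2.0 = "{((True, i), k)}"
          and ?K1.0 = "{((b, j), k'). k' < k \<or> k' = k \<and> (\<not> b \<or> j \<noteq> i)}"
          and ?F1.0 = "\<lambda>g. w_of g k i" and ?F2.0 = "\<lambda>g. n_of g k i"])
    show "w_of g k i = w_of g' k i"
      if "\<And>p. p \<in> {((b, j), k'). k' < k \<or> k' = k \<and> (\<not> b \<or> j \<noteq> i)} \<Longrightarrow> g p = g' p" for g g'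
      using that by (rule dep)
    show "n_of g k i = n_of g' k i" if "\<And>p. p \<in> {((True, i), k)} \<Longrightarrow> g p = g' p" for g g'
      using that by simp
  qed ((fact w_of_measurable coordinate_measurable)+, auto)
  then show ?thesis by (simp add: Z_def[abs_def] S_def[abs_def] W_def[abs_def])
qed

text \<open>
  With \<open>v x = x * exp (\<theta> * x)\<close> and \<open>h x = exp (\<theta> * x)\<close>, the rate \<open>z / s\<close> at which \<open>v z\<close> is lost satisfies
  \<open>v z * z / s \<ge> 2 * v z / \<alpha> - h z * s / \<alpha>\<^sup>2\<close> by the arithmetic-geometric mean inequality, and the cross
  terms \<open>h (z i) * z j\<close> in \<open>h z * s\<close> split by the tangent line bound into \<open>v (z i)\<close> and \<open>h (z j) / \<theta>\<close>.
  Only the lower-order moments of \<open>h\<close> at the other sites survive, hence no translation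
  invariance is needed.
\<close>

lemma drift_step:
  fixes \<theta> C H :: real
  assumes \<theta>: "0 < \<theta>"
    and intV: "\<And>j. integrable M (\<lambda>\<omega>. real (Z k j \<omega>) * exp (\<theta> * real (Z k j \<omega>)))"
    and V: "\<And>j. expectation (\<lambda>\<omega>. real (Z k j \<omega>) * exp (\<theta> * real (Z k j \<omega>))) \<le> C"
    and inth: "\<And>j. integrable M (\<lambda>\<omega>. exp (\<theta> * real (Z k j \<omega>)))"
    and h: "\<And>j. expectation (\<lambda>\<omega>. exp (\<theta> * real (Z k j \<omega>))) \<le> H"
    and q: "0 \<le> 1 - (1 - exp (- \<theta>)) * \<kappa> / \<alpha>"
  shows "integrable M (\<lambda>\<omega>. real (Z (Suc k) i \<omega>) * exp (\<theta> * real (Z (Suc k) i \<omega>)))" (is ?int)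
    and "expectation (\<lambda>\<omega>. real (Z (Suc k) i \<omega>) * exp (\<theta> * real (Z (Suc k) i \<omega>)))
      \<le> exp (\<mu> * (exp \<theta> - 1)) * ((1 - (1 - exp (- \<theta>)) * \<kappa> / \<alpha>) * C + \<kappa> / \<alpha> * ((1 / \<theta> + \<mu>) * H))
        + \<mu> * exp \<theta> * exp (\<mu> * (exp \<theta> - 1)) * H" (is ?bound)
    and "AE \<omega> in M. S k i \<omega> < \<infinity>" (is ?fin)
proof -
  define v h where "v x = x * exp (\<theta> * x)" and "h x = exp (\<theta> * x)" for x :: real
  have v_nn: "0 \<le> v (real x)" for x :: nat by (simp add: v_def)
  have vm[measurable]: "v \<in> borel_measurable borel" and hm[measurable]: "h \<in> borel_measurable borel"
    unfolding v_def h_def by measurable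
  have h_pos: "0 < h x" for x by (simp add: h_def)
  have h_ge1: "1 \<le> h (real x)" for x :: nat using \<theta> by (simp add: h_def)
  let ?EV = "expectation (\<lambda>\<omega>. v (Z k i \<omega>))"
  \<comment> \<open>The lower-order part: \<open>H / \<theta>\<close> comes from the tangent line
    bound and \<open>H * \<mu>\<close> from the arrivals of the step, which are independent of
    \<open>Z k i\<close>.\<close>
  let ?K = "(1 / \<theta> + \<mu>) * H"
  have intv: "integrable M (\<lambda>\<omega>. v (Z k j \<omega>))" and EV: "expectation (\<lambda>\<omega>. v (Z k j \<omega>)) \<le> C"
    and inth': "integrable M (\<lambda>\<omega>. h (Z k j \<omega>))" and Eh: "expectation (\<lambda>\<omega>. h (Z k j \<omega>)) \<le> H" for j
    using intV[of j] V[of j] inth[of j] h[of j] by (simp_all add: v_def h_def)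
  interpret Ni: poisson_variable M "N k i" \<mu> by (rule N_poisson)
  have Nint: "integrable M (\<lambda>\<omega>. real (N k j \<omega>))" and EN: "expectation (\<lambda>\<omega>. real (N k j \<omega>)) = \<mu>" for j
  proof -
    interpret Nj: poisson_variable M "N k j" \<mu> by (rule N_poisson)
    show "integrable M (\<lambda>\<omega>. real (N k j \<omega>))" "expectation (\<lambda>\<omega>. real (N k j \<omega>)) = \<mu>"
      using Nj.mean_exp_moment[of 0] by simp_all
  qed
  have hN: "integrable M (\<lambda>\<omega>. h (Z k i \<omega>) * real (N k j \<omega>))"
    "expectation (\<lambda>\<omega>. h (Z k i \<omega>) * real (N k j \<omega>)) \<le> H * \<mu>" for j
  proof -
    have "indep_var borel ((\<lambda>z. h (real z)) \<circ> Z k i) borel (real \<circ> N k j)"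
      by (rule indep_var_compose[OF indep_Z_N]) auto
    then have i: "indep_var borel (\<lambda>\<omega>. h (Z k i \<omega>)) borel (\<lambda>\<omega>. real (N k j \<omega>))"
      by (simp add: comp_def)
    show "integrable M (\<lambda>\<omega>. h (Z k i \<omega>) * real (N k j \<omega>))"
      by (rule indep_var_integrable[OF i inth' Nint])
    show "expectation (\<lambda>\<omega>. h (Z k i \<omega>) * real (N k j \<omega>)) \<le> H * \<mu>"
      unfolding indep_var_lebesgue_integral[OF i inth' Nint] EN
      using Eh \<mu> by (rule mult_right_mono)
  qed
  have H0: "0 \<le> H"
  proof -
    have "0 \<le> expectation (\<lambda>\<omega>. h (Z k i \<omega>))"
      using h_pos by (intro integral_nonneg_AE) (auto simp: less_imp_le)
    then show ?thesis using Eh[of i] by simp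
  qed
  have EV0: "0 \<le> ?EV" using v_nn by simp
  have K0: "0 \<le> ?K" using H0 \<theta> \<mu> by simp
  let ?n = "\<lambda>j \<omega>. real (Z k (i - j) \<omega> + (if j = 0 then 0 else N k (i - j) \<omega>))"
  have n_m[measurable]: "?n j \<in> borel_measurable M" for j by (cases "j = 0") auto
  have pair: "(\<integral>\<^sup>+\<omega>. ennreal (h (Z k i \<omega>) * ?n j \<omega>) \<partial>M) \<le> ennreal (?EV + ?K)" for j
  proof -
    let ?b = "\<lambda>\<omega>. v (Z k i \<omega>) + h (Z k (i - j) \<omega>) / \<theta> + h (Z k i \<omega>) * real (N k (i - j) \<omega>)"
    have le: "h (Z k i \<omega>) * ?n j \<omega> \<le> ?b \<omega>" for \<omega>
      using exp_mult_young[OF \<theta>, of "Z k i \<omega>" "Z k (i - j) \<omega>"] h_pos[of "Z k i \<omega>"]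
      by (auto simp: v_def h_def algebra_simps intro: add_nonneg_nonneg)
    have intb: "integrable M ?b" using intv inth' hN by auto
    have "(\<integral>\<^sup>+\<omega>. ennreal (h (Z k i \<omega>) * ?n j \<omega>) \<partial>M) \<le> (\<integral>\<^sup>+\<omega>. ennreal (?b \<omega>) \<partial>M)"
      using le by (intro nn_integral_mono ennreal_leI)
    also have "\<dots> = ennreal (expectation ?b)"
      using h_pos v_nn \<theta> by (intro nn_integral_eq_integral[OF intb] AE_I2) (auto simp: less_imp_le)
    also have "expectation ?b = ?EV + expectation (\<lambda>\<omega>. h (Z k (i - j) \<omega>)) / \<theta>
        + expectation (\<lambda>\<omega>. h (Z k i \<omega>) * real (N k (i - j) \<omega>))"
      using intv inth' hN by simp
    also have "\<dots> \<le> ?EV + H / \<theta> + H * \<mu>"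
      using Eh hN \<theta> by (intro add_mono divide_right_mono) auto
    also have "\<dots> = ?EV + ?K" by (simp add: algebra_simps)
    finally show ?thesis using ennreal_leI by simp
  qed
  \<comment> \<open>The bound \<open>pair\<close> is uniform in \<open>j\<close>, so Tonelli gives
    it the total weight \<alpha>.\<close>
  have hS: "(\<integral>\<^sup>+\<omega>. ennreal (h (Z k i \<omega>)) * S k i \<omega> \<partial>M) \<le> ennreal (\<alpha> * (?EV + ?K))"
  proof -
    have "(\<integral>\<^sup>+\<omega>. ennreal (h (Z k i \<omega>)) * S k i \<omega> \<partial>M)
       = (\<integral>\<^sup>+\<omega>. \<integral>\<^sup>+j. ennreal (a j) * ennreal (h (Z k i \<omega>) * ?n j \<omega>) \<partial>count_space UNIV \<partial>M)"
      unfolding S_def load_def using a_nonneg h_pos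
      by (simp add: nn_integral_cmult[symmetric] ennreal_mult'' ennreal_mult' less_imp_le mult_ac)
    also have "\<dots> = (\<integral>\<^sup>+j. \<integral>\<^sup>+\<omega>. ennreal (a j) * ennreal (h (Z k i \<omega>) * ?n j \<omega>) \<partial>M \<partial>count_space UNIV)"
    proof (rule nn_integral_count_space_nn_integral)
      fix j
      show "(\<lambda>\<omega>. ennreal (a j) * ennreal (h (Z k i \<omega>) * ?n j \<omega>)) \<in> borel_measurable M"
        using n_m[of j] by measurable
    qed simp
    also have "\<dots> = (\<integral>\<^sup>+j. ennreal (a j) * (\<integral>\<^sup>+\<omega>. ennreal (h (Z k i \<omega>) * ?n j \<omega>) \<partial>M) \<partial>count_space UNIV)"
      by (intro nn_integral_cong nn_integral_cmult) measurable
    also have "\<dots> \<le> (\<integral>\<^sup>+j. ennreal (a j) * ennreal (?EV + ?K) \<partial>count_space UNIV)"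
      using pair by (intro nn_integral_mono mult_left_mono) auto
    also have "\<dots> = ennreal (\<alpha> * (?EV + ?K))"
      using EV0 K0 \<alpha>_pos by (simp add: nn_integral_multc a_sum ennreal_mult)
    finally show ?thesis .
  qed
  \<comment> \<open>Since \<open>h\<close> is at least 1 on queue lengths, the weighted bound
    already makes the mean load finite.\<close>
  show fin: ?fin
  proof -
    have "(\<integral>\<^sup>+\<omega>. S k i \<omega> \<partial>M) \<le> (\<integral>\<^sup>+\<omega>. ennreal (h (Z k i \<omega>)) * S k i \<omega> \<partial>M)"
    proof (rule nn_integral_mono)
      fix \<omega>
      have "ennreal 1 * S k i \<omega> \<le> ennreal (h (Z k i \<omega>)) * S k i \<omega>"
        using h_ge1 by (intro mult_right_mono ennreal_leI) auto
      then show "S k i \<omega> \<le> ennreal (h (Z k i \<omega>)) * S k i \<omega>" by simp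
    qed
    also note hS
    finally have "(\<integral>\<^sup>+\<omega>. S k i \<omega> \<partial>M) \<noteq> \<infinity>" by (auto simp: top_unique)
    from nn_integral_PInf_AE[OF _ this] show ?thesis
      by (auto simp: less_top)
  qed
  let ?s = "\<lambda>\<omega>. enn2real (S k i \<omega>)"
  have ints: "integrable M (\<lambda>\<omega>. h (Z k i \<omega>) * ?s \<omega>)"
    and Es: "expectation (\<lambda>\<omega>. h (Z k i \<omega>) * ?s \<omega>) \<le> \<alpha> * (?EV + ?K)"
  proof -
    have "(\<integral>\<^sup>+\<omega>. ennreal (h (Z k i \<omega>) * ?s \<omega>) \<partial>M) = (\<integral>\<^sup>+\<omega>. ennreal (h (Z k i \<omega>)) * S k i \<omega> \<partial>M)"
      using fin h_pos by (intro nn_integral_cong_AE) (auto simp: ennreal_mult' less_imp_le elim!: eventually_mono)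
    with hS have le: "(\<integral>\<^sup>+\<omega>. ennreal (h (Z k i \<omega>) * ?s \<omega>) \<partial>M) \<le> ennreal (\<alpha> * (?EV + ?K))" by simp
    then have "(\<integral>\<^sup>+\<omega>. ennreal (h (Z k i \<omega>) * ?s \<omega>) \<partial>M) < \<infinity>"
      by (rule le_less_trans) simp
    then show i: "integrable M (\<lambda>\<omega>. h (Z k i \<omega>) * ?s \<omega>)"
      using h_pos by (intro integrableI_nonneg) (auto simp: less_imp_le)
    have "ennreal (expectation (\<lambda>\<omega>. h (Z k i \<omega>) * ?s \<omega>)) \<le> ennreal (\<alpha> * (?EV + ?K))"
      using le h_pos by (subst (asm) nn_integral_eq_integral[OF i]) (auto simp: less_imp_le)
    then show "expectation (\<lambda>\<omega>. h (Z k i \<omega>) * ?s \<omega>) \<le> \<alpha> * (?EV + ?K)"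
      using EV0 K0 \<alpha>_pos by (subst (asm) ennreal_le_iff) auto
  qed
  define B where "B \<omega> = (1 \<le> Z k i \<omega> \<and> U k i \<omega> * ?s \<omega> \<le> real (Z k i \<omega>))" for \<omega>
  have Bm[measurable]: "Measurable.pred M B" unfolding B_def by measurable
  have intB: "integrable M (\<lambda>\<omega>. of_bool (B \<omega>) * v (Z k i \<omega>))"
    by (rule Bochner_Integration.integrable_bound[OF intv[of i]]) (auto simp: v_nn)
  have EB: "\<kappa> * (?EV - ?K) / \<alpha> \<le> expectation (\<lambda>\<omega>. of_bool (B \<omega>) * v (Z k i \<omega>))"
  proof -
    let ?f = "\<lambda>p u. ennreal (of_bool (1 \<le> fst p \<and> u * enn2real (snd p) \<le> real (fst p)) * v (real (fst p)))"
    \<comment> \<open>The tangent to z / s at s = \<alpha> * z, times \<kappa> * v z. It is linear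
      in the load, so \<open>Es\<close> controls its expectation although nothing is known about the
      expectation of z / s.\<close>
    let ?g = "\<lambda>\<omega>. \<kappa> * (2 * v (Z k i \<omega>) / \<alpha> - h (Z k i \<omega>) * ?s \<omega> / \<alpha>\<^sup>2)"
    have intg: "integrable M ?g" using intv ints by auto
    have inner: "AE \<omega> in M. ennreal (?g \<omega>) \<le> (\<integral>\<^sup>+\<omega>'. ?f (Z k i \<omega>, S k i \<omega>) (U k i \<omega>') \<partial>M)"
      using fin
    proof eventually_elim
      case (elim \<omega>)
      show ?case
      proof (cases "1 \<le> Z k i \<omega>")
        case True
        define z s where "z = real (Z k i \<omega>)" and "s = ?s \<omega>"
        have z: "1 \<le> z" using True by (simp add: z_def)
        \<comment> \<open>Because \<open>a 0 = 1\<close>, the load contains the queue itself. Thus z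
          / s is at most 1, the range covered by \<open>U_lower\<close>.\<close>
        have "ennreal z \<le> S k i \<omega>"
        proof -
          have "ennreal z = (\<integral>\<^sup>+j. ennreal (a j * real (Z k (i - j) \<omega> + (if j = 0 then 0 else N k (i - j) \<omega>)))
              * indicator {0} j \<partial>count_space UNIV)"
            by (subst nn_integral_indicator_singleton) (auto simp: a_0 z_def)
          also have "\<dots> \<le> S k i \<omega>"
            unfolding S_def load_def by (intro nn_integral_mono) (auto split: split_indicator)
          finally show ?thesis .
        qed
        then have "enn2real (ennreal z) \<le> s"
          unfolding s_def using elim by (intro enn2real_mono) auto
        then have zs: "z \<le> s" using z by simp
        have "?g \<omega> \<le> \<kappa> * (z / s) * v z"
        proof -
          have "2 / \<alpha> - s / (\<alpha>\<^sup>2 * z) \<le> z / s"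
          proof -
            have "0 \<le> (s - \<alpha> * z)\<^sup>2 / (\<alpha>\<^sup>2 * z * s)" using z zs by simp
            also have "\<dots> = z / s - (2 / \<alpha> - s / (\<alpha>\<^sup>2 * z))"
              using z zs \<alpha>_pos by (simp add: field_simps power2_eq_square)
            finally show ?thesis by simp
          qed
          then have "(2 / \<alpha> - s / (\<alpha>\<^sup>2 * z)) * v z \<le> z / s * v z"
            using v_nn[of "Z k i \<omega>"] by (intro mult_right_mono) (auto simp: z_def)
          moreover have "(2 / \<alpha> - s / (\<alpha>\<^sup>2 * z)) * v z = 2 * v z / \<alpha> - h z * s / \<alpha>\<^sup>2"
            using z by (simp add: v_def h_def field_simps)
          ultimately have "2 * v z / \<alpha> - h z * s / \<alpha>\<^sup>2 \<le> z / s * v z" by simp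
          then show ?thesis using \<kappa> unfolding z_def[symmetric] s_def[symmetric]
            by (metis mult.assoc mult_left_mono)
        qed
        also have "\<dots> \<le> prob {\<omega>' \<in> space M. U k i \<omega>' \<le> z / s} * v z"
          using z zs v_nn[of "Z k i \<omega>"] by (intro mult_right_mono U_lower) (auto simp: z_def)
        finally have "ennreal (?g \<omega>) \<le> ennreal (v z) * emeasure M {\<omega>' \<in> space M. U k i \<omega>' \<le> z / s}"
          using v_nn[of "Z k i \<omega>"]
          by (simp add: emeasure_eq_measure ennreal_mult''[symmetric] z_def ennreal_leI mult.commute)
        also have "\<dots> = (\<integral>\<^sup>+\<omega>'. ennreal (v z) * indicator {\<omega>' \<in> space M. U k i \<omega>' \<le> z / s} \<omega>' \<partial>M)"
          by (rule nn_integral_cmult_indicator[symmetric]) measurable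
        also have "\<dots> = (\<integral>\<^sup>+\<omega>'. ?f (Z k i \<omega>, S k i \<omega>) (U k i \<omega>') \<partial>M)"
          using z zs by (intro nn_integral_cong)
            (auto simp: z_def s_def field_simps split: split_indicator)
        finally show ?thesis .
      next
        case False
        then have "?g \<omega> \<le> 0" using \<kappa> h_pos by (auto simp: v_def not_le less_imp_le mult_nonneg_nonpos)
        then show ?thesis by (simp add: ennreal_neg)
      qed
    qed
    \<comment> \<open>\<open>?g\<close> may be negative, and \<open>ennreal\<close> truncates it at
      0; the comparison therefore passes through its positive part.\<close>
    have "ennreal (expectation ?g) \<le> (\<integral>\<^sup>+\<omega>. ennreal (?g \<omega>) \<partial>M)"
    proof -
      have "expectation ?g \<le> expectation (\<lambda>\<omega>. max 0 (?g \<omega>))"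
        using intg by (intro integral_mono) auto
      then have "ennreal (expectation ?g) \<le> ennreal (expectation (\<lambda>\<omega>. max 0 (?g \<omega>)))" by (rule ennreal_leI)
      also have "\<dots> = (\<integral>\<^sup>+\<omega>. ennreal (max 0 (?g \<omega>)) \<partial>M)"
        using intg by (intro nn_integral_eq_integral[symmetric]) auto
      also have "\<dots> = (\<integral>\<^sup>+\<omega>. ennreal (?g \<omega>) \<partial>M)"
        by (intro nn_integral_cong) (auto simp: max_def ennreal_neg)
      finally show ?thesis .
    qed
    also have "\<dots> \<le> (\<integral>\<^sup>+\<omega>. \<integral>\<^sup>+\<omega>'. ?f (Z k i \<omega>, S k i \<omega>) (U k i \<omega>') \<partial>M \<partial>M)"
      by (rule nn_integral_mono_AE[OF inner])
    also have "\<dots> = (\<integral>\<^sup>+\<omega>. ?f (Z k i \<omega>, S k i \<omega>) (U k i \<omega>) \<partial>M)"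
      by (rule nn_integral_ZS_U[symmetric]) measurable
    also have "\<dots> = (\<integral>\<^sup>+\<omega>. ennreal (of_bool (B \<omega>) * v (Z k i \<omega>)) \<partial>M)"
      by (simp add: B_def)
    also have "\<dots> = ennreal (expectation (\<lambda>\<omega>. of_bool (B \<omega>) * v (Z k i \<omega>)))"
      by (rule nn_integral_eq_integral[OF intB]) (auto simp: v_nn)
    finally have "expectation ?g \<le> expectation (\<lambda>\<omega>. of_bool (B \<omega>) * v (Z k i \<omega>))"
      by (subst (asm) ennreal_le_iff) (auto intro!: integral_nonneg_AE simp: v_nn)
    moreover have "expectation ?g = \<kappa> * (2 * ?EV / \<alpha> - expectation (\<lambda>\<omega>. h (Z k i \<omega>) * ?s \<omega>) / \<alpha>\<^sup>2)"
      using intv ints by simp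
    moreover have "\<kappa> * (2 * ?EV / \<alpha> - (\<alpha> * (?EV + ?K)) / \<alpha>\<^sup>2)
        \<le> \<kappa> * (2 * ?EV / \<alpha> - expectation (\<lambda>\<omega>. h (Z k i \<omega>) * ?s \<omega>) / \<alpha>\<^sup>2)"
      using Es \<kappa> \<alpha>_pos by (intro mult_left_mono diff_mono divide_right_mono) auto
    moreover have "\<kappa> * (2 * ?EV / \<alpha> - (\<alpha> * (?EV + ?K)) / \<alpha>\<^sup>2) = \<kappa> * (?EV - ?K) / \<alpha>"
      using \<alpha>_pos by (simp add: field_simps power2_eq_square)
    ultimately show ?thesis by linarith
  qed
  have W: "W k i \<omega> = (if B \<omega> then Z k i \<omega> - 1 else Z k i \<omega>)" for \<omega>
    by (simp add: W_def thinned_def B_def S_def)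
  \<comment> \<open>A departure costs at least the fraction 1 - exp (- \<theta>) of
    \<open>v\<close>: only the exponential factor is used, the loss in the linear factor is given
    away.\<close>
  have vW: "v (W k i \<omega>) \<le> v (Z k i \<omega>) - (1 - exp (- \<theta>)) * (of_bool (B \<omega>) * v (Z k i \<omega>))" for \<omega>
  proof (cases "B \<omega>")
    case True
    then have z: "1 \<le> Z k i \<omega>" by (simp add: B_def)
    have "v (real (Z k i \<omega> - 1)) = (real (Z k i \<omega>) - 1) * (exp (- \<theta>) * exp (\<theta> * real (Z k i \<omega>)))"
      using z by (simp add: v_def of_nat_diff exp_add[symmetric] algebra_simps)
    also have "\<dots> \<le> real (Z k i \<omega>) * (exp (- \<theta>) * exp (\<theta> * real (Z k i \<omega>)))"
      by (intro mult_right_mono) auto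
    finally show ?thesis using True by (simp add: W v_def algebra_simps)
  qed (simp add: W)
  have intvW: "integrable M (\<lambda>\<omega>. v (W k i \<omega>))"
  proof (rule Bochner_Integration.integrable_bound[OF intv[of i]])
    show "AE \<omega> in M. norm (v (W k i \<omega>)) \<le> norm (v (Z k i \<omega>))"
    proof (rule AE_I2)
      fix \<omega>
      have "0 \<le> (1 - exp (- \<theta>)) * (of_bool (B \<omega>) * v (Z k i \<omega>))" using \<theta> v_nn by simp
      then show "norm (v (W k i \<omega>)) \<le> norm (v (Z k i \<omega>))" using vW[of \<omega>] v_nn by simp
    qed
  qed auto
  have hW: "h (W k i \<omega>) \<le> h (Z k i \<omega>)" for \<omega> using \<theta> by (auto simp: W h_def)
  have inthW: "integrable M (\<lambda>\<omega>. h (W k i \<omega>))"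
    by (rule Bochner_Integration.integrable_bound[OF inth'[of i]]) (use hW h_pos in \<open>auto simp: less_imp_le\<close>)
  have EhW: "expectation (\<lambda>\<omega>. h (W k i \<omega>)) \<le> H"
    using integral_mono[OF inthW inth'[of i] hW] Eh[of i] by simp
  have EvW: "expectation (\<lambda>\<omega>. v (W k i \<omega>)) \<le> (1 - (1 - exp (- \<theta>)) * \<kappa> / \<alpha>) * C + \<kappa> / \<alpha> * ?K"
  proof -
    have e1: "0 \<le> 1 - exp (- \<theta>)" "1 - exp (- \<theta>) \<le> 1" using \<theta> by auto
    have "expectation (\<lambda>\<omega>. v (W k i \<omega>))
        \<le> expectation (\<lambda>\<omega>. v (Z k i \<omega>) - (1 - exp (- \<theta>)) * (of_bool (B \<omega>) * v (Z k i \<omega>)))"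
      using intvW intv intB vW by (intro integral_mono) auto
    also have "\<dots> = ?EV - (1 - exp (- \<theta>)) * expectation (\<lambda>\<omega>. of_bool (B \<omega>) * v (Z k i \<omega>))"
      using intv intB by simp
    also have "\<dots> \<le> ?EV - (1 - exp (- \<theta>)) * (\<kappa> * (?EV - ?K) / \<alpha>)"
      using EB e1 by (intro diff_mono mult_left_mono) auto
    also have "\<dots> = (1 - (1 - exp (- \<theta>)) * \<kappa> / \<alpha>) * ?EV + (1 - exp (- \<theta>)) * (\<kappa> / \<alpha> * ?K)"
      by (simp add: algebra_simps diff_divide_distrib add_divide_distrib)
    \<comment> \<open>By \<open>q\<close> the coefficient of \<open>?EV\<close> is nonnegative, so
      the bound \<open>C\<close> may be inserted; in the lower-order term 1 - exp (- \<theta>) is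
      replaced by 1.\<close>
    also have "\<dots> \<le> (1 - (1 - exp (- \<theta>)) * \<kappa> / \<alpha>) * C + 1 * (\<kappa> / \<alpha> * ?K)"
    proof (intro add_mono mult_left_mono mult_right_mono EV q e1(2))
      show "0 \<le> \<kappa> / \<alpha> * ?K" using \<kappa> \<alpha>_pos K0 by simp
    qed
    finally show ?thesis by simp
  qed
  have iv: "indep_var borel (\<lambda>\<omega>. v (W k i \<omega>)) borel (\<lambda>\<omega>. exp (\<theta> * real (N k i \<omega>)))"
    using indep_var_compose[OF indep_W_N, of "\<lambda>w. v (real w)" borel "\<lambda>n. exp (\<theta> * real n)" borel]
    by (simp add: comp_def)
  have ih: "indep_var borel (\<lambda>\<omega>. h (W k i \<omega>)) borel (\<lambda>\<omega>. real (N k i \<omega>) * exp (\<theta> * real (N k i \<omega>)))"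
    using indep_var_compose[OF indep_W_N, of "\<lambda>w. h (real w)" borel "\<lambda>n. real n * exp (\<theta> * real n)" borel]
    by (simp add: comp_def)
  \<comment> \<open>Expanding the linear factor of (w + n) * exp (\<theta> * (w + n)) leaves two
    products of a function of \<open>W k i\<close> and a function of \<open>N k i\<close>, which are
    independent.\<close>
  have eq: "real (Z (Suc k) i \<omega>) * exp (\<theta> * real (Z (Suc k) i \<omega>))
     = v (W k i \<omega>) * exp (\<theta> * real (N k i \<omega>)) + h (W k i \<omega>) * (real (N k i \<omega>) * exp (\<theta> * real (N k i \<omega>)))" for \<omega>
    by (simp add: Z_Suc v_def h_def algebra_simps exp_add)
  note i1 = indep_var_integrable[OF iv intvW Ni.exp_moment(1)]
    and i2 = indep_var_integrable[OF ih inthW Ni.mean_exp_moment(1)]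
  show ?int unfolding eq by (rule Bochner_Integration.integrable_add[OF i1 i2])
  have "expectation (\<lambda>\<omega>. real (Z (Suc k) i \<omega>) * exp (\<theta> * real (Z (Suc k) i \<omega>)))
     = expectation (\<lambda>\<omega>. v (W k i \<omega>)) * exp (\<mu> * (exp \<theta> - 1))
       + expectation (\<lambda>\<omega>. h (W k i \<omega>)) * (\<mu> * exp \<theta> * exp (\<mu> * (exp \<theta> - 1)))"
    unfolding eq Bochner_Integration.integral_add[OF i1 i2]
      indep_var_lebesgue_integral[OF iv intvW Ni.exp_moment(1)]
      indep_var_lebesgue_integral[OF ih inthW Ni.mean_exp_moment(1)]
      Ni.exp_moment(2) Ni.mean_exp_moment(2) ..
  also have "\<dots> \<le> ((1 - (1 - exp (- \<theta>)) * \<kappa> / \<alpha>) * C + \<kappa> / \<alpha> * ?K) * exp (\<mu> * (exp \<theta> - 1))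
       + H * (\<mu> * exp \<theta> * exp (\<mu> * (exp \<theta> - 1)))"
    using EvW EhW \<mu> by (intro add_mono mult_right_mono) auto
  finally show ?bound by (simp add: mult_ac)
qed

end

text \<open>
  The bound is preserved by the recursion of \<open>drift_step\<close> once \<open>h\<close> is estimated by \<open>\<eta> * v + exp (\<theta> / \<eta>)\<close>
  with \<open>\<eta>\<close> so small that half of the contraction remains.
\<close>

definition moment_bound :: "real \<Rightarrow> real \<Rightarrow> real \<Rightarrow> real \<Rightarrow> real" where
  "moment_bound \<alpha> \<mu> \<kappa> \<theta> =
    (let \<phi> = exp (\<mu> * (exp \<theta> - 1)); q = \<phi> * (1 - (1 - exp (- \<theta>)) * \<kappa> / \<alpha>);
         c = \<phi> * (\<kappa> / \<alpha> * (1 / \<theta> + \<mu>)) + \<mu> * exp \<theta> * \<phi>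
     in 2 * c * exp (\<theta> * (2 * (c + 1) / (1 - q))) / (1 - q))"

section \<open>Uniform moments and exponential tails of the dominating system\<close>

context thinned_queues
begin

lemma moments:
  fixes \<theta> :: real
  defines "C \<equiv> moment_bound \<alpha> \<mu> \<kappa> \<theta>"
  assumes \<theta>: "0 < \<theta>"
    and q0: "0 \<le> 1 - (1 - exp (- \<theta>)) * \<kappa> / \<alpha>"
    and q1: "exp (\<mu> * (exp \<theta> - 1)) * (1 - (1 - exp (- \<theta>)) * \<kappa> / \<alpha>) < 1"
  shows "integrable M (\<lambda>\<omega>. real (Z k i \<omega>) * exp (\<theta> * real (Z k i \<omega>)))"
    and "expectation (\<lambda>\<omega>. real (Z k i \<omega>) * exp (\<theta> * real (Z k i \<omega>))) \<le> C"
    and "AE \<omega> in M. S k i \<omega> < \<infinity>"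
proof -
  define \<phi> where "\<phi> = exp (\<mu> * (exp \<theta> - 1))"
  define q where "q = \<phi> * (1 - (1 - exp (- \<theta>)) * \<kappa> / \<alpha>)"
  define c where "c = \<phi> * (\<kappa> / \<alpha> * (1 / \<theta> + \<mu>)) + \<mu> * exp \<theta> * \<phi>"
  \<comment> \<open>Chosen so that c * \<eta> is at most (1 - q) / 2: the part of \<open>H\<close>
    proportional to \<open>C\<close> consumes at most half of the gap 1 - q.\<close>
  define \<eta> where "\<eta> = (1 - q) / (2 * (c + 1))"
  define H where "H = \<eta> * C + exp (\<theta> / \<eta>)"
  have \<phi>: "0 < \<phi>" by (simp add: \<phi>_def)
  have c0: "0 \<le> c" unfolding c_def using \<phi> \<kappa> \<mu> \<theta> \<alpha>_pos by simp
  have q: "q < 1" using q1 by (simp add: q_def \<phi>_def)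
  have \<eta>: "0 < \<eta>" using q c0 by (simp add: \<eta>_def)
  \<comment> \<open>The other half of the gap is matched exactly: c * exp (\<theta> / \<eta>) equals
    (1 - q) / 2 * C.\<close>
  have C: "C = 2 * c * exp (\<theta> / \<eta>) / (1 - q)"
    unfolding C_def moment_bound_def Let_def \<phi>_def[symmetric] q_def[symmetric] c_def[symmetric]
    by (simp add: \<eta>_def)
  have C0: "0 \<le> C" unfolding C using c0 q by simp
  have h_le: "exp (\<theta> * real x) \<le> \<eta> * (real x * exp (\<theta> * real x)) + exp (\<theta> / \<eta>)" for x :: nat
  proof (cases "1 \<le> \<eta> * real x")
    case True
    then have "1 * exp (\<theta> * real x) \<le> \<eta> * real x * exp (\<theta> * real x)"
      by (intro mult_right_mono) auto
    then show ?thesis by (simp add: mult.assoc add_increasing2)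
  next
    case False
    then have "real x \<le> 1 / \<eta>" using \<eta> by (simp add: field_simps)
    then have "\<theta> * real x \<le> \<theta> / \<eta>" using \<theta> mult_left_mono[of "real x" "1 / \<eta>" \<theta>] by simp
    then have "exp (\<theta> * real x) \<le> exp (\<theta> / \<eta>)" by simp
    then show ?thesis using \<eta> by (simp add: add_increasing)
  qed
  have inth: "integrable M (\<lambda>\<omega>. exp (\<theta> * real (Z k j \<omega>)))"
    and Eh: "expectation (\<lambda>\<omega>. exp (\<theta> * real (Z k j \<omega>))) \<le> H"
    if int: "integrable M (\<lambda>\<omega>. real (Z k j \<omega>) * exp (\<theta> * real (Z k j \<omega>)))"
      and V: "expectation (\<lambda>\<omega>. real (Z k j \<omega>) * exp (\<theta> * real (Z k j \<omega>))) \<le> C" for k j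
  proof -
    have ib: "integrable M (\<lambda>\<omega>. \<eta> * (real (Z k j \<omega>) * exp (\<theta> * real (Z k j \<omega>))) + exp (\<theta> / \<eta>))"
      using int by simp
    show i: "integrable M (\<lambda>\<omega>. exp (\<theta> * real (Z k j \<omega>)))"
      by (rule Bochner_Integration.integrable_bound[OF ib])
         (use h_le \<eta> in \<open>auto intro!: AE_I2 order_trans[OF h_le]\<close>)
    have "expectation (\<lambda>\<omega>. exp (\<theta> * real (Z k j \<omega>)))
        \<le> expectation (\<lambda>\<omega>. \<eta> * (real (Z k j \<omega>) * exp (\<theta> * real (Z k j \<omega>))) + exp (\<theta> / \<eta>))"
      using i ib h_le by (intro integral_mono) auto
    also have "\<dots> = \<eta> * expectation (\<lambda>\<omega>. real (Z k j \<omega>) * exp (\<theta> * real (Z k j \<omega>))) + exp (\<theta> / \<eta>)"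
      using int by (simp add: prob_space)
    also have "\<dots> \<le> H" unfolding H_def using V \<eta> by simp
    finally show "expectation (\<lambda>\<omega>. exp (\<theta> * real (Z k j \<omega>))) \<le> H" .
  qed
  have close: "\<phi> * ((1 - (1 - exp (- \<theta>)) * \<kappa> / \<alpha>) * C + \<kappa> / \<alpha> * ((1 / \<theta> + \<mu>) * H)) + \<mu> * exp \<theta> * \<phi> * H \<le> C"
  proof -
    have "\<phi> * ((1 - (1 - exp (- \<theta>)) * \<kappa> / \<alpha>) * C + \<kappa> / \<alpha> * ((1 / \<theta> + \<mu>) * H)) + \<mu> * exp \<theta> * \<phi> * H = q * C + c * H"
      by (simp only: q_def c_def) (simp only: distrib_left distrib_right mult_ac)
    also have "\<dots> = q * C + (c * \<eta>) * C + c * exp (\<theta> / \<eta>)" by (simp add: H_def algebra_simps)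
    also have "c * exp (\<theta> / \<eta>) = (1 - q) / 2 * C" using q by (simp add: C)
    also have "q * C + (c * \<eta>) * C + (1 - q) / 2 * C \<le> q * C + (1 - q) / 2 * C + (1 - q) / 2 * C"
    proof (intro add_mono mult_right_mono C0 order_refl)
      show "c * \<eta> \<le> (1 - q) / 2" using c0 q by (simp add: \<eta>_def field_simps)
    qed
    also have "\<dots> = C" by (simp add: field_simps)
    finally show ?thesis .
  qed
  \<comment> \<open>The induction treats all sites at once, because the drift at one site uses the
    moment bounds at every other site.\<close>
  have V: "(\<forall>j. integrable M (\<lambda>\<omega>. real (Z k j \<omega>) * exp (\<theta> * real (Z k j \<omega>))))
    \<and> (\<forall>j. expectation (\<lambda>\<omega>. real (Z k j \<omega>) * exp (\<theta> * real (Z k j \<omega>))) \<le> C)" for k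
  proof (induction k)
    case 0
    then show ?case using C0 by (simp add: Z_0)
  next
    case (Suc k)
    then show ?case
      using drift_step(1,2)[OF \<theta>, of k C H, OF _ _ inth Eh q0] close
      unfolding \<phi>_def[symmetric] by (meson order_trans)
  qed
  then show "integrable M (\<lambda>\<omega>. real (Z k i \<omega>) * exp (\<theta> * real (Z k i \<omega>)))"
    "expectation (\<lambda>\<omega>. real (Z k i \<omega>) * exp (\<theta> * real (Z k i \<omega>))) \<le> C" by auto
  show "AE \<omega> in M. S k i \<omega> < \<infinity>"
    using V[of k] by (intro drift_step(3)[OF \<theta>, of k C H] inth Eh q0) auto
qed

text \<open>Markov's inequality for the moment; as \<open>n\<close> is at least 1, the linear factor
  of the weight is at least 1 on the event.\<close>

lemma tail_bound:
  assumes \<theta>: "0 < \<theta>"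
    and q0: "0 \<le> 1 - (1 - exp (- \<theta>)) * \<kappa> / \<alpha>"
    and q1: "exp (\<mu> * (exp \<theta> - 1)) * (1 - (1 - exp (- \<theta>)) * \<kappa> / \<alpha>) < 1"
    and n: "1 \<le> n"
  shows "prob {\<omega> \<in> space M. n \<le> Z k i \<omega>} \<le> moment_bound \<alpha> \<mu> \<kappa> \<theta> * exp (- \<theta> * real n)"
proof -
  let ?V = "\<lambda>\<omega>. real (Z k i \<omega>) * exp (\<theta> * real (Z k i \<omega>))"
  have "prob {\<omega> \<in> space M. n \<le> Z k i \<omega>} \<le> prob {\<omega> \<in> space M. exp (\<theta> * real n) \<le> ?V \<omega>}"
  proof (intro finite_measure_mono subsetI CollectI conjI)
    fix \<omega> assume "\<omega> \<in> {\<omega> \<in> space M. n \<le> Z k i \<omega>}"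
    then have z: "n \<le> Z k i \<omega>" by simp
    then have "1 * exp (\<theta> * real n) \<le> real (Z k i \<omega>) * exp (\<theta> * real (Z k i \<omega>))"
      using n \<theta> by (intro mult_mono) auto
    then show "exp (\<theta> * real n) \<le> ?V \<omega>" by simp
  qed auto
  also have "\<dots> \<le> expectation ?V / exp (\<theta> * real n)"
    by (rule integral_Markov_inequality_measure[where A = "space M", OF moments(1)[OF \<theta> q0 q1]]) auto
  also have "\<dots> \<le> moment_bound \<alpha> \<mu> \<kappa> \<theta> / exp (\<theta> * real n)"
    by (intro divide_right_mono moments(2)[OF \<theta> q0 q1]) simp
  finally show ?thesis by (simp add: exp_minus divide_inverse)
qed

end

text \<open>After 1 - y \<le> exp (- y), the logarithm of the factor is at most \<delta> * (1 - exp
  (- \<theta>)) * (lam * exp \<theta> - (1 - \<delta> / 2) / \<alpha>). Its last factor is negative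
  for small \<delta> and \<theta> exactly because lam * \<alpha> < 1.\<close>

lemma ex_contraction_parameters:
  fixes lam \<alpha> :: real
  assumes lam: "0 < lam" and \<alpha>: "1 \<le> \<alpha>" and stable: "lam * \<alpha> < 1"
  obtains \<delta> \<theta> where "0 < \<delta>" "\<delta> < 1" "0 < \<theta>"
    "0 \<le> 1 - (1 - exp (- \<theta>)) * (\<delta> - \<delta>\<^sup>2 / 2) / \<alpha>"
    "exp (lam * \<delta> * (exp \<theta> - 1)) * (1 - (1 - exp (- \<theta>)) * (\<delta> - \<delta>\<^sup>2 / 2) / \<alpha>) < 1"
proof -
  have la: "0 < lam * \<alpha>" using lam \<alpha> by simp
  \<comment> \<open>The slack in the stability condition; with it lam * \<alpha> = 1 - \<delta> lies
    below 1 - \<delta> / 2.\<close>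
  define \<delta> where "\<delta> = 1 - lam * \<alpha>"
  have \<delta>: "0 < \<delta>" "\<delta> < 1" using stable la by (auto simp: \<delta>_def)
  \<comment> \<open>The value of exp \<theta> at which the bracket lam * exp \<theta> - (1 -
    \<delta> / 2) / \<alpha> vanishes; \<theta> is taken halfway to it on the logarithmic
    scale.\<close>
  define r where "r = (1 - \<delta> / 2) / (lam * \<alpha>)"
  have "lam * \<alpha> < 1 - \<delta> / 2" using stable unfolding \<delta>_def by (simp add: field_simps)
  then have r: "1 < r" using la by (simp add: r_def)
  define \<theta> where "\<theta> = ln r / 2"
  have \<theta>: "0 < \<theta>" and e\<theta>: "exp \<theta> < r"
  proof -
    show "0 < \<theta>" using r by (simp add: \<theta>_def)
    have "\<theta> < ln r" using r by (simp add: \<theta>_def)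
    then show "exp \<theta> < r" using r by (metis exp_less_mono exp_ln less_trans zero_less_one)
  qed
  have e1: "0 < 1 - exp (- \<theta>)" "1 - exp (- \<theta>) \<le> 1" using \<theta> by auto
  have \<kappa>: "0 \<le> \<delta> - \<delta>\<^sup>2 / 2" "\<delta> - \<delta>\<^sup>2 / 2 \<le> 1"
  proof -
    have "\<delta>\<^sup>2 \<le> \<delta>" using \<delta> by (simp add: power2_eq_square mult_left_le)
    then show "0 \<le> \<delta> - \<delta>\<^sup>2 / 2" using \<delta> by simp
    show "\<delta> - \<delta>\<^sup>2 / 2 \<le> 1" using \<delta> by (smt (verit) zero_le_power2 divide_nonneg_nonneg)
  qed
  have 1: "(1 - exp (- \<theta>)) * (\<delta> - \<delta>\<^sup>2 / 2) / \<alpha> \<le> 1"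
  proof -
    have "(1 - exp (- \<theta>)) * (\<delta> - \<delta>\<^sup>2 / 2) \<le> 1 * 1" using e1 \<kappa> by (intro mult_mono) auto
    then show ?thesis using \<alpha> by simp
  qed
  have "exp (lam * \<delta> * (exp \<theta> - 1)) * (1 - (1 - exp (- \<theta>)) * (\<delta> - \<delta>\<^sup>2 / 2) / \<alpha>)
     \<le> exp (lam * \<delta> * (exp \<theta> - 1)) * exp (- ((1 - exp (- \<theta>)) * (\<delta> - \<delta>\<^sup>2 / 2) / \<alpha>))"
    using exp_ge_add_one_self[of "- ((1 - exp (- \<theta>)) * (\<delta> - \<delta>\<^sup>2 / 2) / \<alpha>)"]
    by (intro mult_left_mono) auto
  also have "\<dots> = exp (lam * \<delta> * (exp \<theta> - 1) - (1 - exp (- \<theta>)) * (\<delta> - \<delta>\<^sup>2 / 2) / \<alpha>)"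
    by (simp only: mult_exp_exp add_uminus_conv_diff)
  also have "lam * \<delta> * (exp \<theta> - 1) - (1 - exp (- \<theta>)) * (\<delta> - \<delta>\<^sup>2 / 2) / \<alpha>
      = \<delta> * (1 - exp (- \<theta>)) * (lam * exp \<theta> - (1 - \<delta> / 2) / \<alpha>)"
  proof -
    have "exp \<theta> * exp (- \<theta>) = 1" by (simp add: exp_minus)
    then have 1: "exp \<theta> - 1 = (1 - exp (- \<theta>)) * exp \<theta>" by (simp add: algebra_simps)
    have 2: "(1 - exp (- \<theta>)) * (\<delta> - \<delta>\<^sup>2 / 2) / \<alpha> = \<delta> * (1 - exp (- \<theta>)) * ((1 - \<delta> / 2) / \<alpha>)"
    proof -
      have "\<delta> - \<delta>\<^sup>2 / 2 = \<delta> * (1 - \<delta> / 2)" by (simp add: power2_eq_square right_diff_distrib)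
      then show ?thesis by (simp add: mult_ac)
    qed
    show ?thesis unfolding 1 2 by (simp only: right_diff_distrib mult_ac)
  qed
  also have "exp \<dots> < 1"
  proof -
    have "lam * exp \<theta> < lam * r" using e\<theta> lam by simp
    also have "lam * r = (1 - \<delta> / 2) / \<alpha>" using lam \<alpha> by (simp add: r_def)
    finally have "lam * exp \<theta> - (1 - \<delta> / 2) / \<alpha> < 0" by simp
    then have "\<delta> * (1 - exp (- \<theta>)) * (lam * exp \<theta> - (1 - \<delta> / 2) / \<alpha>) < 0"
      using \<delta> e1 by (intro mult_pos_neg) auto
    then show ?thesis by simp
  qed
  finally show ?thesis using that[of \<delta> \<theta>] \<delta> \<theta> 1 by auto
qed

section \<open>Pathwise domination\<close>

lemma nn_integral_count_space_has_sum:
  fixes f :: "'i \<Rightarrow> real"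
  assumes f: "\<And>j. 0 \<le> f j"
  shows "f summable_on UNIV \<Longrightarrow> (\<integral>\<^sup>+j. ennreal (f j) \<partial>count_space UNIV) = ennreal (infsum f UNIV)"
    and "(\<integral>\<^sup>+j. ennreal (f j) \<partial>count_space UNIV) < \<infinity> \<Longrightarrow>
      (f has_sum enn2real (\<integral>\<^sup>+j. ennreal (f j) \<partial>count_space UNIV)) UNIV"
proof -
  show 1: "(\<integral>\<^sup>+j. ennreal (f j) \<partial>count_space UNIV) = ennreal (infsum f UNIV)" if s: "f summable_on UNIV"
  proof -
    have a: "Infinite_Set_Sum.abs_summable_on f UNIV"
      using s f abs_summable_equivalent[of f UNIV] by simp
    show ?thesis
      using nn_integral_conv_infsetsum[OF a] infsetsum_infsum[OF a] f by simp
  qed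
  assume fin: "(\<integral>\<^sup>+j. ennreal (f j) \<partial>count_space UNIV) < \<infinity>"
  then have "integrable (count_space UNIV) f"
    using f by (intro integrableI_nonneg) auto
  then have s: "f summable_on UNIV"
    using f abs_summable_equivalent[of f UNIV] by (simp add: Infinite_Set_Sum.abs_summable_on_def)
  then show "(f has_sum enn2real (\<integral>\<^sup>+j. ennreal (f j) \<partial>count_space UNIV)) UNIV"
    unfolding 1[OF s] using f by (simp add: infsum_nonneg)
qed

locale queue_path =
  fixes a :: "int ^ 'd \<Rightarrow> real" and \<alpha> :: "int ^ 'd \<Rightarrow> real set"
    and \<delta> :: "int ^ 'd \<Rightarrow> (real \<times> real) set" and s0 :: real and x :: "int ^ 'd \<Rightarrow> real \<Rightarrow> nat"
  assumes a: "interference_sequence a"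
    and path: "queue_path_from_empty a \<alpha> \<delta> s0 x"
    and \<alpha>_finite: "\<And>i. locally_finite (\<alpha> i)"
    and \<delta>_finite: "\<And>i. locally_finite (\<delta> i)"
    and \<delta>_marks: "\<And>i. \<delta> i \<subseteq> UNIV \<times> {0..1}"
begin

definition left_limit :: "real \<Rightarrow> int ^ 'd \<Rightarrow> nat" where
  "left_limit r k = Lim (at_left r) (x k)"

abbreviation "arrivals i s t \<equiv> {r \<in> \<alpha> i. s < r \<and> r \<le> t}"
abbreviation "atoms i s t \<equiv> {(r, u) \<in> \<delta> i. s < r \<and> r \<le> t}"
abbreviation "departures i s t \<equiv>
  {(r, u) \<in> \<delta> i. s < r \<and> r \<le> t \<and> u \<le> departure_rate a (left_limit r) i}"

lemma finite_arrivals: "finite (arrivals i s t)"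
proof -
  have "finite (\<alpha> i \<inter> {s..t})" using \<alpha>_finite[of i] by (simp add: locally_finite_def)
  then show ?thesis by (rule finite_subset[rotated]) auto
qed

lemma finite_atoms: "finite (atoms i s t)"
proof -
  have "bounded ({s..t} \<times> {0..1::real})" by (intro bounded_Times) auto
  then have "finite (\<delta> i \<inter> ({s..t} \<times> {0..1}))" using \<delta>_finite[of i] by (simp add: locally_finite_def)
  then show ?thesis using \<delta>_marks[of i] by (elim finite_subset[rotated]) auto
qed

lemma finite_departures: "finite (departures i s t)"
  by (rule finite_subset[OF _ finite_atoms[of i s t]]) auto

lemma path_eq:
  "s0 \<le> t \<Longrightarrow> int (x i t) = int (card (arrivals i s0 t)) - int (card (departures i s0 t))"
  using path by (simp add: queue_path_from_empty_def left_limit_def[abs_def])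

lemma increment:
  assumes "s0 \<le> s" "s \<le> t"
  shows "int (x i t) = int (x i s) + int (card (arrivals i s t)) - int (card (departures i s t))"
proof -
  have "arrivals i s0 t = arrivals i s0 s \<union> arrivals i s t"
    "departures i s0 t = departures i s0 s \<union> departures i s t" using assms by auto
  moreover have "card (arrivals i s0 s \<union> arrivals i s t) = card (arrivals i s0 s) + card (arrivals i s t)"
    by (intro card_Un_disjoint finite_arrivals) auto
  moreover have "card (departures i s0 s \<union> departures i s t) = card (departures i s0 s) + card (departures i s t)"
    by (intro card_Un_disjoint finite_departures) auto
  ultimately show ?thesis using path_eq[of s i] path_eq[of t i] assms by simp
qed

lemma initially_empty: "x i s0 = 0"
proof -
  have e: "arrivals i s0 s0 = {}" "departures i s0 s0 = {}" by auto
  show ?thesis using path_eq[of s0 i] unfolding e by simp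
qed

lemma le_arrivals:
  assumes "s0 \<le> s" "s \<le> t"
  shows "x i t \<le> x i s + card (arrivals i s t)"
  using increment[OF assms, of i] by simp

lemma ge_atoms:
  assumes "s0 \<le> s" "s \<le> t"
  shows "card (arrivals i s t) \<le> x i t + card (atoms i s t)"
proof -
  have "card (departures i s t) \<le> card (atoms i s t)"
    by (intro card_mono finite_atoms) auto
  then show ?thesis using increment[OF assms, of i] by simp
qed

text \<open>Jumps of \<open>x j\<close> can occur only at arrivals and atoms, which are locally
  finite in time. So the left limit is an actual value shortly before \<open>r\<close>, and bounds
  at times before \<open>r\<close> carry over to it.\<close>

lemma left_limit_attained:
  assumes "s0 \<le> b" "b < r"
  obtains y where "b < y" "y < r" "x j y = left_limit r j"
proof -
  let ?F = "arrivals j b r \<union> fst ` atoms j b r"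
  \<comment> \<open>The last possible jump strictly between \<open>b\<close> and \<open>r\<close>,
    or \<open>b\<close> if there is none.\<close>
  define b' where "b' = Max (insert b (?F - {r}))"
  have fin: "finite (insert b (?F - {r}))" using finite_arrivals finite_atoms by simp
  have F: "z \<le> b'" if "z \<in> ?F - {r}" for z
    unfolding b'_def using that fin by (intro Max_ge) auto
  have b': "b \<le> b'" unfolding b'_def using fin by (intro Max_ge) auto
  have "b' < r" unfolding b'_def using fin assms by (subst Max_less_iff) auto
  have const: "x j y = x j y'" if y: "b' < y" "y \<le> y'" "y' < r" for y y'
  proof -
    have e: "arrivals j y y' = {}" "departures j y y' = {}"
    proof -
      have out: "w \<notin> ?F" if "y < w" "w \<le> y'" for w
        using F[of w] that y by auto
      have w: "b < w" "w < r" if "y < w" "w \<le> y'" for w using that y b' by auto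
      show "arrivals j y y' = {}"
      proof (intro equals0I, elim CollectE conjE)
        fix w assume "w \<in> \<alpha> j" "y < w" "w \<le> y'"
        with w[of w] have "w \<in> arrivals j b r" by simp
        then show False using out[of w] \<open>y < w\<close> \<open>w \<le> y'\<close> by blast
      qed
      show "departures j y y' = {}"
      proof (rule equals0I, clarify)
        fix w v assume "(w, v) \<in> \<delta> j" "y < w" "w \<le> y'"
        with w[of w] have "(w, v) \<in> atoms j b r" by simp
        then have "w \<in> fst ` atoms j b r" by (rule rev_image_eqI) simp
        then show False using out[of w] \<open>y < w\<close> \<open>w \<le> y'\<close> by blast
      qed
    qed
    have "int (x j y') = int (x j y)" using increment[of y y' j, unfolded e] y b' assms by simp
    then show ?thesis by simp
  qed
  define y where "y = (b' + r) / 2"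
  have y: "b' < y" "y < r" using \<open>b' < r\<close> by (auto simp: y_def)
  have "eventually (\<lambda>z. x j z = x j y) (at_left r)"
    unfolding eventually_at_left_field
  proof (intro exI conjI allI impI)
    show "b' < r" by fact
    fix z assume "b' < z" "z < r"
    show "x j z = x j y"
    proof (cases "z \<le> y")
      case True
      show ?thesis by (rule const) fact+
    next
      case False
      show ?thesis by (rule const[symmetric]) (use False y \<open>z < r\<close> in auto)
    qed
  qed
  then have "(x j \<longlongrightarrow> x j y) (at_left r)" by (rule tendsto_eventually)
  then have "left_limit r j = x j y"
    unfolding left_limit_def by (intro tendsto_Lim) auto
  then show ?thesis using that[of y] y b' by simp
qed

text \<open>Longer queues elsewhere only lower the rate and are already counted in the load. The
  surplus y i - z i at the site itself enters numerator and interference sum alike because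
  \<open>a 0 = 1\<close>, and this can only raise the rate.\<close>

lemma departure_rate_ge:
  fixes z n :: "int ^ 'd \<Rightarrow> nat"
  assumes load: "load a z n i < \<infinity>"
    and y_le: "\<And>j. y j \<le> z j + n j" and z: "1 \<le> z i" "z i \<le> y i"
  shows "real (z i) \<le> enn2real (load a z n i)"
    and "real (z i) / enn2real (load a z n i) \<le> departure_rate a y i"
proof -
  have a0: "a 0 = 1" and a_nn: "0 \<le> a j" for j
    using a by (auto simp: interference_sequence_def)
  let ?b = "\<lambda>j. a j * real (z (i - j) + (if j = 0 then 0 else n (i - j)))"
  let ?s = "enn2real (load a z n i)"
  have b: "(?b has_sum ?s) UNIV"
    using nn_integral_count_space_has_sum(2)[of ?b] a_nn load unfolding load_def by simp
  show zs: "real (z i) \<le> ?s"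
  proof -
    have "(?b has_sum real (z i)) {0}" using a0 by (intro has_sum_finiteI) auto
    then show ?thesis using b by (rule has_sum_mono_neutral) (auto simp: a_nn)
  qed
  let ?c = "\<lambda>j. ?b j + (if j = 0 then real (y i) - real (z i) else 0)"
  have "((\<lambda>j. if j = 0 then real (y i) - real (z i) else 0) has_sum (real (y i) - real (z i))) (UNIV :: (int ^ 'd) set)"
    by (rule has_sum_finite_neutralI[where B="{0}"]) auto
  then have c: "(?c has_sum (?s + (real (y i) - real (z i)))) UNIV"
    by (rule has_sum_add[OF b])
  have le: "a j * real (y (i - j)) \<le> ?c j" for j
  proof (cases "j = 0")
    case False
    then show ?thesis using mult_left_mono[of "real (y (i - j))" "real (z (i - j) + n (i - j))" "a j"] y_le[of "i - j"] a_nn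
      by simp
  qed (simp add: a0)
  \<comment> \<open>Without summability \<open>infsum\<close> would be 0 and the departure rate 0 by
    convention, so the finite load is essential here.\<close>
  have summ: "(\<lambda>j. a j * real (y (i - j))) summable_on UNIV"
  proof (rule summable_on_comparison_test)
    show "?c summable_on UNIV" using c by (auto simp: summable_on_def)
  qed (use le a_nn in auto)
  define D where "D = (\<Sum>\<^sub>\<infinity>j. a j * real (y (i - j)))"
  have D: "((\<lambda>j. a j * real (y (i - j))) has_sum D) UNIV"
    unfolding D_def using summ by simp
  have D_le: "D \<le> ?s + (real (y i) - real (z i))"
    using has_sum_mono[OF D c] le by auto
  have D_ge: "real (y i) \<le> D"
  proof -
    have "((\<lambda>j. a j * real (y (i - j))) has_sum real (y i)) {0}" using a0 by (intro has_sum_finiteI) auto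
    then show ?thesis using D by (rule has_sum_mono_neutral) (auto simp: a_nn)
  qed
  \<comment> \<open>Adding one nonnegative number to numerator and denominator of a fraction at most
    1 does not decrease it.\<close>
  have "real (z i) / ?s \<le> real (y i) / (?s + (real (y i) - real (z i)))"
  proof -
    have "0 \<le> (?s - real (z i)) * (real (y i) - real (z i))" using zs z by simp
    then have "real (z i) * (?s + (real (y i) - real (z i))) \<le> real (y i) * ?s"
      by (simp add: algebra_simps)
    then show ?thesis using zs z by (simp add: frac_le_eq divide_simps mult.commute)
  qed
  also have "\<dots> \<le> real (y i) / D"
    using D_le D_ge z by (intro divide_left_mono) auto
  finally show "real (z i) / ?s \<le> departure_rate a y i"
    by (simp add: departure_rate_def D_def)
qed

text \<open>
  Either the queue is at least as long as \<open>z i\<close> just before the atom with the least mark, and then it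
  loses a customer there, or it is already shorter than \<open>z i\<close> at that moment.
\<close>

lemma dominated_step:
  fixes z n :: "int ^ 'd \<Rightarrow> nat" and u :: "int ^ 'd \<Rightarrow> real"
  assumes t: "s0 \<le> t" "t \<le> t'"
    and n: "\<And>j. n j = card (arrivals j t t')"
    and u: "u i \<le> 1 \<Longrightarrow> \<exists>r w. (r, w) \<in> \<delta> i \<and> t < r \<and> r \<le> t' \<and> w \<le> u i"
    and load: "load a z n i < \<infinity>"
    and z: "\<And>j. x j t \<le> z j"
  shows "x i t' \<le> thinned a z n u i + n i"
proof (cases "1 \<le> z i \<and> u i * enn2real (load a z n i) \<le> real (z i)")
  case False
  then have "thinned a z n u i = z i" by (auto simp: thinned_def)
  then show ?thesis using le_arrivals[OF t, of i] z[of i] n[of i] by simp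
next
  case True
  let ?s = "enn2real (load a z n i)"
  have th: "thinned a z n u i = z i - 1" using True by (simp add: thinned_def)
  have zs: "real (z i) \<le> ?s"
    using departure_rate_ge(1)[OF load, of z] True by simp
  \<comment> \<open>The mark is at most z / s and hence at most 1. This rules out the placeholder
    for an empty window, so an atom with such a mark exists.\<close>
  then have us: "u i \<le> real (z i) / ?s" using True by (simp add: pos_le_divide_eq)
  also have "\<dots> \<le> 1" using zs True by simp
  finally obtain r w where r: "(r, w) \<in> \<delta> i" "t < r" "r \<le> t'" "w \<le> u i" using u by blast
  have y_le: "left_limit r j \<le> z j + n j" for j
  proof -
    obtain y where y: "t < y" "y < r" "x j y = left_limit r j"
      using left_limit_attained[of t r j] t r by auto
    have "card (arrivals j t y) \<le> card (arrivals j t t')"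
      using y r by (intro card_mono finite_arrivals) auto
    then show ?thesis using le_arrivals[of t y j] y t z[of j] n[of j] by simp
  qed
  show ?thesis
  proof (cases "z i \<le> left_limit r i")
    case True
    then have "w \<le> departure_rate a (left_limit r) i"
      using departure_rate_ge(2)[OF load y_le _ True] \<open>1 \<le> z i \<and> _\<close> r(4) us by simp
    then have "{(r, w)} \<subseteq> departures i t t'" using r by auto
    then have "card {(r, w)} \<le> card (departures i t t')" by (intro card_mono finite_departures)
    then have "1 \<le> card (departures i t t')" by simp
    then show ?thesis using increment[OF t, of i] z[of i] n[of i] th by simp
  next
    case False
    obtain y where y: "t < y" "y < r" "x i y = left_limit r i"
      using left_limit_attained[of t r i] t r by auto
    have "card (arrivals i y t') \<le> card (arrivals i t t')"
      using y by (intro card_mono finite_arrivals) auto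
    then show ?thesis using le_arrivals[of y t' i] y t r False n[of i] th by simp
  qed
qed

lemma dominated:
  fixes n :: "nat \<Rightarrow> int ^ 'd \<Rightarrow> nat" and u :: "nat \<Rightarrow> int ^ 'd \<Rightarrow> real"
  assumes h: "0 \<le> h"
    and n: "\<And>k j. n k j = card (arrivals j (s0 + real k * h) (s0 + real (Suc k) * h))"
    and u: "\<And>k i. u k i \<le> 1 \<Longrightarrow>
      \<exists>r w. (r, w) \<in> \<delta> i \<and> s0 + real k * h < r \<and> r \<le> s0 + real (Suc k) * h \<and> w \<le> u k i"
    and load: "\<And>k i. load a (dominating a n u k) (n k) i < \<infinity>"
  shows "x i (s0 + real k * h) \<le> dominating a n u k i"
proof (induction k arbitrary: i)
  case 0
  then show ?case by (simp add: initially_empty)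
next
  case (Suc k)
  have "x i (s0 + real (Suc k) * h) \<le> thinned a (dominating a n u k) (n k) (u k) i + n k i"
    using h by (intro dominated_step[where t="s0 + real k * h"] n u load Suc) (auto intro: mult_right_mono)
  then show ?case by simp
qed

end

section \<open>The driving processes in a partition of time\<close>

lemma space_config_space: "space (config_space E) = {S. S \<subseteq> E \<and> locally_finite S}"
  unfolding config_space_def by (rule space_measure_of) auto

lemma card_Int_measurable:
  assumes "B \<in> sets borel" "bounded B"
  shows "(\<lambda>S. card (S \<inter> B)) \<in> measurable (config_space E) (count_space UNIV)"
proof (subst measurable_count_space_eq2_countable, safe)
  fix n
  have "{S. S \<subseteq> E \<and> locally_finite S \<and> card (S \<inter> B) = n} \<in> sets (config_space E)"
    unfolding config_space_def using assms by (intro in_measure_of) auto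
  also have "{S. S \<subseteq> E \<and> locally_finite S \<and> card (S \<inter> B) = n}
      = (\<lambda>S. card (S \<inter> B)) -` {n} \<inter> space (config_space E)"
    by (auto simp: space_config_space)
  finally show "(\<lambda>S. card (S \<inter> B)) -` {n} \<inter> space (config_space E) \<in> sets (config_space E)" .
qed auto

text \<open>The value \<open>2\<close>, larger than every mark, stands for the absence of atoms.\<close>

definition least_mark :: "real set \<Rightarrow> (real \<times> real) set \<Rightarrow> real" where
  "least_mark T S = Min (insert 2 (snd ` (S \<inter> (T \<times> {0..1}))))"

lemma finite_marks:
  fixes S :: "(real \<times> real) set"
  assumes "locally_finite S" "bounded T"
  shows "finite (S \<inter> (T \<times> {0..1}))"
proof -
  have "bounded (T \<times> {0..1::real})" using assms(2) by (rule bounded_Times) simp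
  then show ?thesis using assms(1) by (simp add: locally_finite_def)
qed

text \<open>Translates marks into counts in rectangles, the only quantities that
  \<open>config_space\<close> and \<open>poisson_process\<close> describe. The cut
  \<open>min u 1\<close> keeps the rectangle inside the strip of marks; for negative
  \<open>u\<close> it is empty.\<close>

lemma least_mark_le_iff:
  assumes "locally_finite S" "bounded T"
  shows "least_mark T S \<le> u \<longleftrightarrow> 2 \<le> u \<or> card (S \<inter> (T \<times> {0..min u 1})) \<noteq> 0"
proof -
  have f: "finite (S \<inter> (T \<times> {0..1}))" by (rule finite_marks) fact+
  have "finite (S \<inter> (T \<times> {0..min u 1}))"
    by (rule finite_subset[OF _ f]) auto
  moreover have "S \<inter> (T \<times> {0..min u 1}) = {p \<in> S \<inter> (T \<times> {0..1}). snd p \<le> u}" by auto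
  ultimately have "card (S \<inter> (T \<times> {0..min u 1})) \<noteq> 0 \<longleftrightarrow> {p \<in> S \<inter> (T \<times> {0..1}). snd p \<le> u} \<noteq> {}"
    by (simp only: card_eq_0_iff) auto
  then have "card (S \<inter> (T \<times> {0..min u 1})) \<noteq> 0 \<longleftrightarrow> (\<exists>p\<in>S \<inter> (T \<times> {0..1}). snd p \<le> u)"
    by (simp only: Collect_empty_eq) blast
  moreover have "least_mark T S \<le> u \<longleftrightarrow> 2 \<le> u \<or> (\<exists>p\<in>S \<inter> (T \<times> {0..1}). snd p \<le> u)"
    unfolding least_mark_def using f by (subst Min_le_iff) auto
  ultimately show ?thesis by simp
qed

lemma least_mark_measurable:
  assumes "T \<in> sets borel" "bounded T"
  shows "least_mark T \<in> borel_measurable (config_space E)"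
proof (rule borel_measurableI_le)
  fix u
  let ?B = "T \<times> {0..min u 1 :: real}"
  have B: "?B \<in> sets borel" "bounded ?B" using assms by (auto intro!: borel_Times bounded_Times)
  note [measurable] = card_Int_measurable[OF B, of E]
  have "{S \<in> space (config_space E). least_mark T S \<le> u}
      = {S \<in> space (config_space E). 2 \<le> u \<or> card (S \<inter> ?B) \<noteq> 0}"
    using assms(2) by (auto simp: space_config_space least_mark_le_iff)
  also have "\<dots> \<in> sets (config_space E)" by measurable
  finally show "{S \<in> space (config_space E). least_mark T S \<le> u} \<in> sets (config_space E)" .
qed

lemma measure_window_strip:
  assumes "0 \<le> h" "0 \<le> u" "u \<le> 1"
  shows "measure (restrict_space lborel (UNIV \<times> {0..1})) ({s<..s + h} \<times> {0..u::real}) = h * (u :: real)"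
    and "{s<..s + h} \<times> {0..u} \<in> sets (restrict_space lborel (UNIV \<times> {0..1}))"
proof -
  have s: "(UNIV \<times> {0..1} :: (real \<times> real) set) \<in> sets lborel"
    by (simp add: borel_Times)
  show "{s<..s + h} \<times> {0..u} \<in> sets (restrict_space lborel (UNIV \<times> {0..1}))"
    using assms s by (subst sets_restrict_space_iff) (auto intro: borel_Times)
  have "emeasure lborel ({s<..s + h} \<times> {0..u}) = emeasure (lborel \<Otimes>\<^sub>M lborel) ({s<..s + h} \<times> {0..u})"
    by (simp add: lborel_prod)
  also have "\<dots> = ennreal (h * u)"
    using assms by (subst lborel.emeasure_pair_measure_Times) (auto simp: ennreal_mult)
  finally have "measure lborel ({s<..s + h} \<times> {0..u}) = h * u"
    using assms by (simp add: measure_def)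
  then show "measure (restrict_space lborel (UNIV \<times> {0..1})) ({s<..s + h} \<times> {0..u}) = h * u"
    using assms s by (subst measure_restrict_space) auto
qed

lemma measure_scaled_window:
  assumes "0 \<le> h" "0 \<le> lam"
  shows "measure (scale_measure (ennreal lam) lborel) {s<..s + h :: real} = lam * h"
  using assms by (simp add: measure_def ennreal_mult[symmetric])

section \<open>Independence of window counts and least marks\<close>

context prob_space
begin

text \<open>Half-lines form an intersection-stable generator of the Borel sets. Events of this kind
  are the ones that \<open>least_mark_le_iff\<close> expresses by counts.\<close>

lemma indep_vars_borel_atMost:
  fixes X :: "'i \<Rightarrow> 'a \<Rightarrow> real"
  assumes rv: "\<And>i. i \<in> I \<Longrightarrow> random_variable borel (X i)"
    and prod: "\<And>J u. J \<noteq> {} \<Longrightarrow> J \<subseteq> I \<Longrightarrow> finite J \<Longrightarrow>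
      prob (\<Inter>j\<in>J. {\<omega> \<in> space M. X j \<omega> \<le> u j}) = (\<Prod>j\<in>J. prob {\<omega> \<in> space M. X j \<omega> \<le> u j})"
  shows "indep_vars (\<lambda>_. borel) X I"
proof -
  let ?E = "\<lambda>i. {X i -` B \<inter> space M | B. B \<in> range (\<lambda>u. {..u})}"
  have "indep_sets ?E I"
  proof (rule indep_setsI)
    show "?E i \<subseteq> events" if "i \<in> I" for i
      using rv[OF that] by (auto intro: measurable_sets)
    fix E J assume J: "J \<noteq> {}" "J \<subseteq> I" "finite J" and "\<forall>j\<in>J. E j \<in> ?E j"
    then have "\<forall>j\<in>J. \<exists>u. E j = {\<omega> \<in> space M. X j \<omega> \<le> u}" by fastforce
    then obtain u where u: "\<forall>j\<in>J. E j = {\<omega> \<in> space M. X j \<omega> \<le> u j}" by metis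
    then have "(\<Inter>j\<in>J. E j) = (\<Inter>j\<in>J. {\<omega> \<in> space M. X j \<omega> \<le> u j})" by auto
    with prod[OF J, of u] u show "prob (\<Inter>j\<in>J. E j) = (\<Prod>j\<in>J. prob (E j))" by simp
  qed
  moreover have "Int_stable (?E i)" for i
  proof (rule Int_stableI)
    fix S T assume "S \<in> ?E i" "T \<in> ?E i"
    then obtain u v where "S = X i -` {..u} \<inter> space M" "T = X i -` {..v} \<inter> space M" by auto
    then have "S \<inter> T = X i -` {..min u v} \<inter> space M" by auto
    then show "S \<inter> T \<in> ?E i" by blast
  qed
  ultimately have "indep_sets (\<lambda>i. sigma_sets (space M) (?E i)) I"
    by (intro indep_sets_sigma)
  moreover have "{X i -` A \<inter> space M |A. A \<in> sets borel} = sigma_sets (space M) (?E i)" for i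
  proof -
    have "sets (borel :: real measure) = sigma_sets UNIV (range (\<lambda>u. {..u}))"
      by (subst borel_eq_atMost) simp
    then show ?thesis by (simp only: sigma_sets_vimage_commute[of "X i" "space M" UNIV, simplified])
  qed
  ultimately show ?thesis using rv unfolding indep_vars_def2 by simp
qed

end

locale driven_queues = prob_space M for M :: "'w measure" +
  fixes lam :: real and A :: "int ^ 'd \<Rightarrow> 'w \<Rightarrow> real set" and D :: "int ^ 'd \<Rightarrow> 'w \<Rightarrow> (real \<times> real) set"
    and s0 h :: real
  assumes driving: "driving_processes M lam A D" and lam: "0 < lam" and h: "0 < h"
begin

definition "window k = {s0 + real k * h<..s0 + real (Suc k) * h}"
definition "N k i \<omega> = card (A i \<omega> \<inter> window k)"
definition "U k i \<omega> = least_mark (window k) (D i \<omega>)"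

abbreviation "CA \<equiv> config_space (UNIV :: real set)"
abbreviation "CD \<equiv> config_space (UNIV \<times> {0..1} :: (real \<times> real) set)"

lemma window_eq: "window k = {s0 + real k * h<..(s0 + real k * h) + h}"
  by (simp add: window_def algebra_simps)

lemma window_borel: "window k \<in> sets borel" "bounded (window k)"
  by (auto simp: window_def)

lemma window_disjoint: "disjoint_family window"
proof -
  have "window k \<inter> window l = {}" if "k < l" for k l
  proof -
    have "real (Suc k) * h \<le> real l * h" using that h by (intro mult_right_mono) auto
    then show ?thesis by (auto simp: window_def)
  qed
  then show ?thesis
    unfolding disjoint_family_on_def by (metis Int_commute nat_neq_iff)
qed

lemma A_poisson: "poisson_process M (scale_measure (ennreal lam) lborel) (A i)"
  and D_poisson: "poisson_process M (restrict_space lborel (UNIV \<times> {0..1})) (D i)"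
  and A_indep: "indep_vars (\<lambda>_. CA) A UNIV"
  and D_indep: "indep_vars (\<lambda>_. CD) D UNIV"
  and A_D_indep: "indep_set
       (sets (vimage_algebra (space M) (\<lambda>\<omega> i. A i \<omega>) (PiM UNIV (\<lambda>_. CA))))
       (sets (vimage_algebra (space M) (\<lambda>\<omega> i. D i \<omega>) (PiM UNIV (\<lambda>_. CD))))"
  using driving by (auto simp: driving_processes_def)

lemma A_measurable[measurable]: "A i \<in> measurable M CA"
  and D_measurable[measurable]: "D i \<in> measurable M CD"
  using A_indep D_indep by (auto simp: indep_vars_def2)

lemma A_config: "\<omega> \<in> space M \<Longrightarrow> locally_finite (A i \<omega>)"
  and D_config: "\<omega> \<in> space M \<Longrightarrow> locally_finite (D i \<omega>)" "\<omega> \<in> space M \<Longrightarrow> D i \<omega> \<subseteq> UNIV \<times> {0..1}"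
  using measurable_space[OF A_measurable, of \<omega> i] measurable_space[OF D_measurable, of \<omega> i]
  by (auto simp: space_config_space)

lemma N_poisson: "poisson_variable M (N k i) (lam * h)"
proof
  show "N k i \<in> measurable M (count_space UNIV)"
    unfolding N_def[abs_def]
    by (rule measurable_compose[OF A_measurable card_Int_measurable[OF window_borel]])
  show "0 \<le> lam * h" using lam h by simp
  fix n
  show "prob {\<omega> \<in> space M. N k i \<omega> = n} = (lam * h) ^ n / fact n * exp (- (lam * h))"
    using A_poisson[of i] window_borel[of k] measure_scaled_window[of h lam "s0 + real k * h"] lam h
    unfolding poisson_process_def N_def by (simp add: window_eq)
qed

lemma U_measurable: "U k i \<in> borel_measurable M"
  unfolding U_def[abs_def]
  by (rule measurable_compose[OF D_measurable least_mark_measurable[OF window_borel]])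

lemma strip: "window k \<times> {0..u} \<in> sets (restrict_space lborel (UNIV \<times> {0..1}))"
    "bounded (window k \<times> {0..u})" if "u \<le> 1" for u :: real
proof -
  show "bounded (window k \<times> {0..u})" by (rule bounded_Times[OF window_borel(2)]) simp
  show "window k \<times> {0..u} \<in> sets (restrict_space lborel (UNIV \<times> {0..1}))"
  proof (cases "0 \<le> u")
    case True
    then show ?thesis using measure_window_strip(2)[of h u] h that by (simp add: window_eq)
  qed simp
qed

lemma U_distr:
  assumes u: "0 \<le> u" "u \<le> 1"
  shows "prob {\<omega> \<in> space M. U k i \<omega> \<le> u} = 1 - exp (- (h * u))"
proof -
  let ?B = "window k \<times> {0..u}"
  have "prob {\<omega> \<in> space M. card (D i \<omega> \<inter> ?B) = 0} = (h * u) ^ 0 / fact 0 * exp (- (h * u))"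
    using D_poisson[of i] strip[OF u(2), of k] measure_window_strip(1)[of h u "s0 + real k * h"] u h
    unfolding poisson_process_def by (simp add: window_eq)
  moreover have "{\<omega> \<in> space M. U k i \<omega> \<le> u} = space M - {\<omega> \<in> space M. card (D i \<omega> \<inter> ?B) = 0}"
    using u window_borel(2)[of k] by (auto simp: U_def least_mark_le_iff[OF D_config(1)] min_absorb1)
  moreover have "{\<omega> \<in> space M. card (D i \<omega> \<inter> ?B) = 0} \<in> events"
  proof -
    have "(\<lambda>\<omega>. card (D i \<omega> \<inter> ?B)) \<in> measurable M (count_space UNIV)"
      by (rule measurable_compose[OF D_measurable card_Int_measurable])
         (auto intro!: borel_Times bounded_Times window_borel)
    then show ?thesis by measurable
  qed
  ultimately show ?thesis by (simp add: prob_compl)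
qed

lemma U_le_oneD:
  assumes "\<omega> \<in> space M" "U k i \<omega> \<le> 1"
  shows "\<exists>r w. (r, w) \<in> D i \<omega> \<and> r \<in> window k \<and> w \<le> U k i \<omega>"
proof -
  have "finite (insert 2 (snd ` (D i \<omega> \<inter> (window k \<times> {0..1}))))"
    using finite_marks[OF D_config(1)[OF assms(1)] window_borel(2)] by simp
  then have "U k i \<omega> \<in> insert 2 (snd ` (D i \<omega> \<inter> (window k \<times> {0..1})))"
    unfolding U_def least_mark_def by (intro Min_in) auto
  then show ?thesis using assms(2) by force
qed

lemma indep_N_time: "indep_vars (\<lambda>_. borel) (\<lambda>k \<omega>. real (N k i \<omega>)) UNIV"
proof -
  have "indep_vars (\<lambda>_. count_space UNIV) (\<lambda>k \<omega>. card (A i \<omega> \<inter> window k)) UNIV"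
    using A_poisson[of i] window_borel window_disjoint unfolding poisson_process_def by auto
  then show ?thesis unfolding N_def by (rule indep_vars_compose2) auto
qed

lemma indep_U_time: "indep_vars (\<lambda>_. borel) (\<lambda>k \<omega>. U k i \<omega>) UNIV"
proof (rule indep_vars_borel_atMost)
  show "random_variable borel (\<lambda>\<omega>. U k i \<omega>)" for k by (rule U_measurable)
  fix J :: "nat set" and u :: "nat \<Rightarrow> real"
  assume J: "J \<noteq> {}" "finite J"
  let ?B = "\<lambda>k. window k \<times> {0..min (u k) 1}"
  \<comment> \<open>If \<open>u k\<close> is at least 2, the event is certain, since the least mark
    never exceeds its placeholder 2; otherwise it says that the rectangle is hit.\<close>
  let ?Q = "\<lambda>k. if 2 \<le> u k then UNIV else - {0::nat}"
  have "disjoint_family ?B"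
    using window_disjoint unfolding disjoint_family_on_def by auto
  then have "indep_vars (\<lambda>_. count_space UNIV) (\<lambda>k \<omega>. card (D i \<omega> \<inter> ?B k)) UNIV"
    using D_poisson[of i] strip[of "min (u _) 1"] unfolding poisson_process_def by simp
  from indep_varsD[OF this, of J ?Q] J
  have "prob (\<Inter>k\<in>J. (\<lambda>\<omega>. card (D i \<omega> \<inter> ?B k)) -` ?Q k \<inter> space M)
      = (\<Prod>k\<in>J. prob ((\<lambda>\<omega>. card (D i \<omega> \<inter> ?B k)) -` ?Q k \<inter> space M))" by simp
  moreover have "(\<lambda>\<omega>. card (D i \<omega> \<inter> ?B k)) -` ?Q k \<inter> space M = {\<omega> \<in> space M. U k i \<omega> \<le> u k}" for k
    using window_borel(2)[of k] by (auto simp: U_def least_mark_le_iff[OF D_config(1)])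
  ultimately show "prob (\<Inter>k\<in>J. {\<omega> \<in> space M. U k i \<omega> \<le> u k}) = (\<Prod>k\<in>J. prob {\<omega> \<in> space M. U k i \<omega> \<le> u k})"
    by simp
qed

abbreviation "sites_algebra b i \<equiv>
  (if b then {A i -` B \<inter> space M | B. B \<in> sets CA} else {D i -` B \<inter> space M | B. B \<in> sets CD})"

text \<open>Merges the three independence statements on the driving processes: arrivals against
  departures is the outer level, the sites are the inner one.\<close>

lemma indep_sites: "indep_sets (\<lambda>(b, i). sites_algebra b i) UNIV"
proof -
  let ?VA = "vimage_algebra (space M) (\<lambda>\<omega> i. A i \<omega>) (PiM UNIV (\<lambda>_. CA))"
  let ?VD = "vimage_algebra (space M) (\<lambda>\<omega> i. D i \<omega>) (PiM UNIV (\<lambda>_. CD))"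
  have sA: "(\<lambda>\<omega> i. A i \<omega>) \<in> space M \<rightarrow> space (PiM UNIV (\<lambda>_. CA))"
    and sD: "(\<lambda>\<omega> i. D i \<omega>) \<in> space M \<rightarrow> space (PiM UNIV (\<lambda>_. CD))"
    using measurable_space[OF A_measurable] measurable_space[OF D_measurable] by (auto simp: space_PiM)
  have "indep_sets (\<lambda>(b, i). sites_algebra b i) (Sigma UNIV (\<lambda>_. UNIV))"
  proof (rule indep_sets_SIGMA[where F = "case_bool (sets ?VA) (sets ?VD)"])
    show "indep_sets (case_bool (sets ?VA) (sets ?VD)) UNIV"
      using A_D_indep unfolding indep_set_def .
    show "indep_sets (sites_algebra b) UNIV" for b
      using A_indep D_indep by (cases b) (auto simp: indep_vars_def2)
    show "Int_stable (case_bool (sets ?VA) (sets ?VD) b)" for b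
      by (cases b) (auto simp: Int_stable_def)
    show "sites_algebra b i \<subseteq> case_bool (sets ?VA) (sets ?VD) b" for b i
    proof (cases b)
      case True
      have "A i -` B \<inter> space M \<in> sets ?VA" if "B \<in> sets CA" for B
      proof -
        have "(\<lambda>f. f i) -` B \<inter> space (PiM UNIV (\<lambda>_. CA)) \<in> sets (PiM UNIV (\<lambda>_. CA))"
          using that by (intro measurable_sets[where A=CA]) auto
        from in_vimage_algebra[OF this, of "\<lambda>\<omega> i. A i \<omega>" "space M"]
        show ?thesis using sA by (auto simp: vimage_def Int_def Pi_iff conj_commute cong: conj_cong)
      qed
      then show ?thesis using True by auto
    next
      case False
      have "D i -` B \<inter> space M \<in> sets ?VD" if "B \<in> sets CD" for B
      proof -
        have "(\<lambda>f. f i) -` B \<inter> space (PiM UNIV (\<lambda>_. CD)) \<in> sets (PiM UNIV (\<lambda>_. CD))"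
          using that by (intro measurable_sets[where A=CD]) auto
        from in_vimage_algebra[OF this, of "\<lambda>\<omega> i. D i \<omega>" "space M"]
        show ?thesis using sD by (auto simp: vimage_def Int_def Pi_iff conj_commute cong: conj_cong)
      qed
      then show ?thesis using False by auto
    qed
  qed
  then show ?thesis by simp
qed

text \<open>Second use of the two-level principle: the outer level is process and site, the inner
  level is time, where Poisson counts in disjoint windows are independent.\<close>

lemma indep_all: "indep_vars (\<lambda>_. borel) (\<lambda>((b, i), k) \<omega>. if b then real (N k i \<omega>) else U k i \<omega>) UNIV"
proof -
  let ?G = "\<lambda>(b, i) k \<omega>. if b then real (N k i \<omega>) else U k i \<omega>"
  have G: "indep_vars (\<lambda>_. borel) (?G p) UNIV" for p
    using indep_N_time[of "snd p"] indep_U_time[of "snd p"] by (cases p; cases "fst p") auto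
  have "indep_sets (\<lambda>(p, k). {?G p k -` B \<inter> space M | B. B \<in> sets borel}) (Sigma UNIV (\<lambda>_. UNIV))"
  proof (rule indep_sets_SIGMA[OF indep_sites])
    show "indep_sets (\<lambda>k. {?G p k -` B \<inter> space M | B. B \<in> sets borel}) UNIV" for p
      using G[of p] by (simp add: indep_vars_def2)
    show "Int_stable (case p of (b, i) \<Rightarrow> sites_algebra b i)" for p
    proof (rule Int_stableI)
      obtain b i where p: "p = (b, i)" by (cases p)
      fix S T assume ST: "S \<in> (case p of (b, i) \<Rightarrow> sites_algebra b i)" "T \<in> (case p of (b, i) \<Rightarrow> sites_algebra b i)"
      show "S \<inter> T \<in> (case p of (b, i) \<Rightarrow> sites_algebra b i)"
      proof (cases b)
        case True
        then obtain B C where "S = A i -` B \<inter> space M" "T = A i -` C \<inter> space M" "B \<in> sets CA" "C \<in> sets CA"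
          using ST p by auto
        then have "S \<inter> T = A i -` (B \<inter> C) \<inter> space M" "B \<inter> C \<in> sets CA" by auto
        then show ?thesis using True p by (auto simp del: vimage_Int)
      next
        case False
        then obtain B C where "S = D i -` B \<inter> space M" "T = D i -` C \<inter> space M" "B \<in> sets CD" "C \<in> sets CD"
          using ST p by auto
        then have "S \<inter> T = D i -` (B \<inter> C) \<inter> space M" "B \<inter> C \<in> sets CD" by auto
        then show ?thesis using False p by (auto simp del: vimage_Int)
      qed
    qed
    show "{?G p k -` B \<inter> space M | B. B \<in> sets borel} \<subseteq> (case p of (b, i) \<Rightarrow> sites_algebra b i)" for p k
    proof
      fix E assume "E \<in> {?G p k -` B \<inter> space M | B. B \<in> sets borel}"
      then obtain B where B: "B \<in> sets borel" and E: "E = ?G p k -` B \<inter> space M" by blast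
      obtain b i where p: "p = (b, i)" by (cases p)
      show "E \<in> (case p of (b, i) \<Rightarrow> sites_algebra b i)"
      proof (cases b)
        case True
        let ?C = "(\<lambda>S. real (card (S \<inter> window k))) -` B \<inter> space CA"
        have "?C \<in> sets CA"
          using B by (intro measurable_sets[OF measurable_compose[OF card_Int_measurable[OF window_borel]]]) auto
        moreover have "?G p k -` B \<inter> space M = A i -` ?C \<inter> space M"
          using True p measurable_space[OF A_measurable] by (auto simp: N_def)
        ultimately show ?thesis using True p E by (auto simp del: vimage_Int)
      next
        case False
        let ?C = "least_mark (window k) -` B \<inter> space CD"
        have "?C \<in> sets CD"
          using B by (intro measurable_sets[OF least_mark_measurable[OF window_borel]]) auto
        moreover have "?G p k -` B \<inter> space M = D i -` ?C \<inter> space M"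
          using False p measurable_space[OF D_measurable] by (auto simp: U_def)
        ultimately show ?thesis using False p E by (auto simp del: vimage_Int)
      qed
    qed
  qed
  then have "indep_sets (\<lambda>(p, k). {?G p k -` B \<inter> space M | B. B \<in> sets borel}) UNIV" by simp
  moreover have "random_variable borel (?G p k)" for p k
    using G[of p] by (auto simp: indep_vars_def2)
  ultimately show ?thesis
    unfolding indep_vars_def2 by (auto simp: case_prod_unfold)
qed

end

text \<open>The product of 1 + x + x^2 / 2 and 1 - x + x^2 / 2 is 1 + x^4 / 4, and the first factor
  is at most exp x.\<close>

lemma exp_minus_le_quadratic:
  fixes x :: real
  assumes "0 \<le> x"
  shows "exp (- x) \<le> 1 - x + x\<^sup>2 / 2"
proof -
  have "1 \<le> (1 + x + x\<^sup>2 / 2) * (1 - x + x\<^sup>2 / 2)"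
    using zero_le_even_power[of 4 x] by (simp add: algebra_simps power2_eq_square power4_eq_xxxx)
  also have "\<dots> \<le> exp x * (1 - x + x\<^sup>2 / 2)"
  proof (rule mult_right_mono)
    show "1 + x + x\<^sup>2 / 2 \<le> exp x" using exp_lower_Taylor_quadratic[OF assms] by simp
    have "0 \<le> (1 - x)\<^sup>2 + 1" by simp
    then show "0 \<le> 1 - x + x\<^sup>2 / 2" by (simp add: power2_eq_square algebra_simps)
  qed
  finally have "exp (- x) * 1 \<le> exp (- x) * (exp x * (1 - x + x\<^sup>2 / 2))"
    by (intro mult_left_mono) auto
  also have "\<dots> = 1 - x + x\<^sup>2 / 2" by (simp add: exp_minus)
  finally show ?thesis by simp
qed

lemma interference_sequence_sum:
  assumes "interference_sequence a"
  shows "1 \<le> infsum a UNIV"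
    and "(\<integral>\<^sup>+j. ennreal (a j) \<partial>count_space UNIV) = ennreal (infsum a UNIV)"
proof -
  have a: "\<And>j. 0 \<le> a j" "a 0 = 1" "a summable_on UNIV"
    using assms by (auto simp: interference_sequence_def)
  have "infsum a {0} \<le> infsum a UNIV"
    using a by (intro infsum_mono_neutral) auto
  then show "1 \<le> infsum a UNIV" using a by simp
  show "(\<integral>\<^sup>+j. ennreal (a j) \<partial>count_space UNIV) = ennreal (infsum a UNIV)"
    using a by (intro nn_integral_count_space_has_sum)
qed

section \<open>Queue length tails and bursts in terms of the driving processes\<close>

context driven_queues
begin

lemma thinned_system:
  assumes a: "interference_sequence a" and h1: "h \<le> 1"
  shows "thinned_queues M a N U (infsum a UNIV) (lam * h) (h - h\<^sup>2 / 2)"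
proof (intro thinned_queues.intro thinned_queues_axioms.intro)
  show "prob_space M" by unfold_locales
  show "0 \<le> a j" "a 0 = 1" for j using a by (auto simp: interference_sequence_def)
  show "(\<integral>\<^sup>+j. ennreal (a j) \<partial>count_space UNIV) = ennreal (infsum a UNIV)" "0 < infsum a UNIV"
    using interference_sequence_sum[OF a] by auto
  show "indep_vars (\<lambda>_. borel) (\<lambda>((b, i), k) \<omega>. if b then real (N k i \<omega>) else U k i \<omega>) UNIV"
    by (rule indep_all)
  show "0 \<le> lam * h" using lam h by simp
  show "poisson_variable M (N k i) (lam * h)" for k i by (rule N_poisson)
  have "h\<^sup>2 \<le> h" using h h1 by (simp add: power2_eq_square mult_left_le)
  then show "0 \<le> h - h\<^sup>2 / 2" using h by simp
  \<comment> \<open>The quadratic bound gives h * u - (h * u)^2 / 2, and u^2 \<le> u turns it into a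
    bound linear in \<open>u\<close>; this is the origin of \<kappa>.\<close>
  show "(h - h\<^sup>2 / 2) * u \<le> prob {\<omega> \<in> space M. U k i \<omega> \<le> u}" if u: "0 \<le> u" "u \<le> 1" for k i u
  proof -
    have "u\<^sup>2 \<le> u" using u by (simp add: power2_eq_square mult_left_le)
    then have "h\<^sup>2 * u\<^sup>2 \<le> h\<^sup>2 * u" by (intro mult_left_mono) auto
    then have "(h - h\<^sup>2 / 2) * u \<le> h * u - (h * u)\<^sup>2 / 2" by (simp add: algebra_simps power_mult_distrib)
    also have "\<dots> \<le> 1 - exp (- (h * u))"
      using exp_minus_le_quadratic[of "h * u"] h u by simp
    finally show ?thesis by (simp add: U_distr[OF u])
  qed
qed

lemma sample_path:
  assumes "interference_sequence a" "\<omega> \<in> space M"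
    and "queue_path_from_empty a (\<lambda>i. A i \<omega>) (\<lambda>i. D i \<omega>) t0 x"
  shows "queue_path a (\<lambda>i. A i \<omega>) (\<lambda>i. D i \<omega>) t0 x"
  by (rule queue_path.intro[OF assms(1,3) A_config D_config]) (use assms(2) in auto)

lemma queue_length_tail:
  fixes Y :: "int ^ 'd \<Rightarrow> real \<Rightarrow> 'w \<Rightarrow> nat"
  assumes a: "interference_sequence a" and h1: "h \<le> 1" and \<theta>: "0 < \<theta>"
    and q0: "0 \<le> 1 - (1 - exp (- \<theta>)) * (h - h\<^sup>2 / 2) / infsum a UNIV"
    and q1: "exp (lam * h * (exp \<theta> - 1)) * (1 - (1 - exp (- \<theta>)) * (h - h\<^sup>2 / 2) / infsum a UNIV) < 1"
    and path: "AE \<omega> in M. queue_path_from_empty a (\<lambda>i. A i \<omega>) (\<lambda>i. D i \<omega>) s0 (\<lambda>i s. Y i s \<omega>)"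
    and n: "1 \<le> n"
  shows "prob {\<omega> \<in> space M. n \<le> Y i (s0 + real K * h) \<omega>}
    \<le> moment_bound (infsum a UNIV) (lam * h) (h - h\<^sup>2 / 2) \<theta> * exp (- \<theta> * real n)"
proof -
  interpret T: thinned_queues M a N U "infsum a UNIV" "lam * h" "h - h\<^sup>2 / 2"
    by (rule thinned_system[OF a h1])
  have dom: "Y i (s0 + real K * h) \<omega> \<le> T.Z K i \<omega>"
    if \<omega>: "\<omega> \<in> space M" and "queue_path_from_empty a (\<lambda>i. A i \<omega>) (\<lambda>i. D i \<omega>) s0 (\<lambda>i s. Y i s \<omega>)"
      and fin: "\<forall>k i. T.S k i \<omega> < \<infinity>" for \<omega>
  proof -
    interpret Q: queue_path a "\<lambda>i. A i \<omega>" "\<lambda>i. D i \<omega>" s0 "\<lambda>i s. Y i s \<omega>"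
      by (rule sample_path[OF a that(1,2)])
    have "Y i (s0 + real K * h) \<omega> \<le> dominating a (\<lambda>k i. N k i \<omega>) (\<lambda>k i. U k i \<omega>) K i"
    proof (rule Q.dominated)
      show "0 \<le> h" using h by simp
      show "N k j \<omega> = card {r \<in> A j \<omega>. s0 + real k * h < r \<and> r \<le> s0 + real (Suc k) * h}" for k j
        unfolding N_def window_def by (rule arg_cong[where f=card]) auto
      show "\<exists>r w. (r, w) \<in> D i \<omega> \<and> s0 + real k * h < r \<and> r \<le> s0 + real (Suc k) * h \<and> w \<le> U k i \<omega>"
        if "U k i \<omega> \<le> 1" for k i
        using U_le_oneD[OF \<omega> that] unfolding window_def by auto
      show "load a (dominating a (\<lambda>k i. N k i \<omega>) (\<lambda>k i. U k i \<omega>) k) (\<lambda>i. N k i \<omega>) i < \<infinity>" for k i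
        using fin unfolding T.S_def T.Z_def by simp
    qed
    then show ?thesis by (simp add: T.Z_def)
  qed
  \<comment> \<open>Domination needs all loads to be finite at once; sites and steps are countable,
    so a single null set suffices.\<close>
  have fin: "AE \<omega> in M. \<forall>k i. T.S k i \<omega> < \<infinity>"
    unfolding AE_all_countable using T.moments(3)[OF \<theta> q0 q1] by blast
  have "AE \<omega> in M. Y i (s0 + real K * h) \<omega> \<le> T.Z K i \<omega>"
    using path fin AE_space by eventually_elim (rule dom)
  then have "prob {\<omega> \<in> space M. n \<le> Y i (s0 + real K * h) \<omega>} \<le> prob {\<omega> \<in> space M. n \<le> T.Z K i \<omega>}"
    by (intro finite_measure_mono_AE) (auto elim!: eventually_mono)
  also note T.tail_bound[OF \<theta> q0 q1 n]
  finally show ?thesis .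
qed

text \<open>The window has mean exactly \<open>k\<close>, so \<open>k\<close> arrivals have
  probability k^k / k! * exp (- k), which is at least exp (- k) as k! \<le> k^k. Absence of atoms
  contributes exp (- h).\<close>

lemma prob_burst:
  assumes k: "lam * h = real k"
  shows "exp (- (real k + h)) \<le> prob {\<omega> \<in> space M. N 0 i \<omega> = k \<and> 1 < U 0 i \<omega>}"
proof -
  interpret Ni: poisson_variable M "N 0 i" "lam * h" by (rule N_poisson)
  let ?X = "\<lambda>((b, i), k) \<omega>. if b then real (N k i \<omega>) else U k i \<omega>"
  let ?I = "{((True, i), 0), ((False, i), 0)} :: ((bool \<times> (int ^ 'd)) \<times> nat) set"
  let ?E = "\<lambda>((b, i), _). if b then {real k} else {1<..}"
  have "prob (\<Inter>p\<in>?I. ?X p -` ?E p \<inter> space M) = (\<Prod>p\<in>?I. prob (?X p -` ?E p \<inter> space M))"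
    by (rule indep_varsD[OF indep_all]) auto
  moreover have "(\<Inter>p\<in>?I. ?X p -` ?E p \<inter> space M) = {\<omega> \<in> space M. N 0 i \<omega> = k \<and> 1 < U 0 i \<omega>}"
    by auto
  moreover have "(\<lambda>\<omega>. real (N 0 i \<omega>)) -` {real k} \<inter> space M = {\<omega> \<in> space M. N 0 i \<omega> = k}"
    "(\<lambda>\<omega>. U 0 i \<omega>) -` {1<..} \<inter> space M = {\<omega> \<in> space M. 1 < U 0 i \<omega>}" by auto
  moreover have "prob {\<omega> \<in> space M. 1 < U 0 i \<omega>} = exp (- h)"
  proof -
    have [measurable]: "U 0 i \<in> borel_measurable M" by (rule U_measurable)
    have "prob {\<omega> \<in> space M. 1 < U 0 i \<omega>} = prob (space M - {\<omega> \<in> space M. U 0 i \<omega> \<le> 1})"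
      by (rule arg_cong[where f=prob]) auto
    also have "\<dots> = 1 - prob {\<omega> \<in> space M. U 0 i \<omega> \<le> 1}" by (rule prob_compl) measurable
    finally show ?thesis using U_distr[of 1 0 i] by simp
  qed
  ultimately have "prob {\<omega> \<in> space M. N 0 i \<omega> = k \<and> 1 < U 0 i \<omega>}
      = real k ^ k / fact k * exp (- real k) * exp (- h)"
    using Ni.N_distr[of k] k by simp
  moreover have "1 \<le> real k ^ k / fact k"
    using fact_le_power[of k, where ?'a = real] by simp
  then have "1 * (exp (- real k) * exp (- h)) \<le> real k ^ k / fact k * (exp (- real k) * exp (- h))"
    by (intro mult_right_mono) auto
  ultimately show ?thesis by (simp add: exp_add[symmetric] mult.assoc)
qed

text \<open>Bursts at different sites use disjoint coordinates and are independent; then 1 - p \<le>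
  exp (- p) at each site.\<close>

lemma prob_no_burst:
  assumes k: "lam * h = real k" and J: "finite J"
  shows "prob {\<omega> \<in> space M. \<forall>i\<in>J. \<not> (N 0 i \<omega> = k \<and> 1 < U 0 i \<omega>)}
    \<le> exp (- (real (card J) * exp (- (real k + h))))"
proof (cases "J = {}")
  case True
  then show ?thesis by (simp add: prob_space)
next
  case False
  let ?X = "\<lambda>((b, i), k) \<omega>. if b then real (N k i \<omega>) else U k i \<omega>"
  let ?K = "\<lambda>i. {((True, i), 0), ((False, i), 0)} :: ((bool \<times> (int ^ 'd)) \<times> nat) set"
  let ?P = "\<lambda>i. PiM (?K i) (\<lambda>_. borel :: real measure)"
  let ?B = "\<lambda>i. {g \<in> space (?P i). \<not> (g ((True, i), 0) = real k \<and> 1 < g ((False, i), 0))}"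
  let ?E = "\<lambda>i. {\<omega> \<in> space M. \<not> (N 0 i \<omega> = k \<and> 1 < U 0 i \<omega>)}"
  have ind: "indep_vars ?P (\<lambda>i \<omega>. restrict (\<lambda>p. ?X p \<omega>) (?K i)) J"
    by (rule indep_vars_restrict[OF indep_all]) (auto simp: disjoint_family_on_def)
  have B: "?B i \<in> sets (?P i)" for i by measurable
  have E: "(\<lambda>\<omega>. restrict (\<lambda>p. ?X p \<omega>) (?K i)) -` ?B i \<inter> space M = ?E i" for i
    by (auto simp: space_PiM)
  have ev: "{\<omega> \<in> space M. N 0 i \<omega> = k \<and> 1 < U 0 i \<omega>} \<in> events" for i
  proof -
    interpret Ni: poisson_variable M "N 0 i" "lam * h" by (rule N_poisson)
    have [measurable]: "U 0 i \<in> borel_measurable M" by (rule U_measurable)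
    show ?thesis by measurable
  qed
  have "{\<omega> \<in> space M. \<forall>i\<in>J. \<not> (N 0 i \<omega> = k \<and> 1 < U 0 i \<omega>)} = (\<Inter>i\<in>J. ?E i)" using False by auto
  then have "prob {\<omega> \<in> space M. \<forall>i\<in>J. \<not> (N 0 i \<omega> = k \<and> 1 < U 0 i \<omega>)} = (\<Prod>i\<in>J. prob (?E i))"
    using indep_varsD[OF ind False J order_refl, of ?B] B unfolding E by simp
  also have "\<dots> \<le> (\<Prod>i\<in>J. exp (- exp (- (real k + h))))"
  proof (rule prod_mono, intro conjI)
    fix i
    have "prob (?E i) = prob (space M - {\<omega> \<in> space M. N 0 i \<omega> = k \<and> 1 < U 0 i \<omega>})"
      by (rule arg_cong[where f=prob]) auto
    also have "\<dots> = 1 - prob {\<omega> \<in> space M. N 0 i \<omega> = k \<and> 1 < U 0 i \<omega>}" by (rule prob_compl[OF ev])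
    also have "\<dots> \<le> 1 + - exp (- (real k + h))" using prob_burst[OF k, of i] by simp
    also have "\<dots> \<le> exp (- exp (- (real k + h)))" by (rule exp_ge_add_one_self)
    finally show "prob (?E i) \<le> exp (- exp (- (real k + h)))" .
  qed simp
  also have "\<dots> = exp (- (real (card J) * exp (- (real k + h))))"
    by (simp add: exp_of_nat_mult[symmetric])
  finally show ?thesis .
qed

text \<open>A least mark above 1 is the placeholder, so the window has no atoms and no departures.
  The \<open>k\<close> arrivals are still present at its end, whatever the earlier history.\<close>

lemma burst_queue_length:
  assumes a: "interference_sequence a" and \<omega>: "\<omega> \<in> space M"
    and path: "queue_path_from_empty a (\<lambda>i. A i \<omega>) (\<lambda>i. D i \<omega>) t0 x" and t0: "t0 \<le> s0"
    and burst: "N 0 i \<omega> = k" "1 < U 0 i \<omega>"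
  shows "k \<le> x i (s0 + h)"
proof -
  interpret Q: queue_path a "\<lambda>i. A i \<omega>" "\<lambda>i. D i \<omega>" t0 x
    by (rule sample_path[OF a \<omega> path])
  have w: "window 0 = {s0<..s0 + h}" by (simp add: window_def)
  have "U 0 i \<omega> \<le> 1 \<longleftrightarrow> 2 \<le> (1::real) \<or> card (D i \<omega> \<inter> (window 0 \<times> {0..min 1 1})) \<noteq> 0"
    unfolding U_def by (rule least_mark_le_iff[OF D_config(1)[OF \<omega>] window_borel(2)])
  with burst(2) have "card (D i \<omega> \<inter> (window 0 \<times> {0..1})) = 0" by simp
  also have "D i \<omega> \<inter> (window 0 \<times> {0..1}) = {(r, u) \<in> D i \<omega>. s0 < r \<and> r \<le> s0 + h}"
    using D_config(2)[OF \<omega>, of i] unfolding w by auto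
  finally have "card {(r, u) \<in> D i \<omega>. s0 < r \<and> r \<le> s0 + h} = 0" .
  moreover have "card {r \<in> A i \<omega>. s0 < r \<and> r \<le> s0 + h} = k"
    using burst(1) unfolding N_def w by (auto intro!: arg_cong[where f=card])
  ultimately show ?thesis using Q.ge_atoms[OF t0, of "s0 + h" i] h by simp
qed

end

section \<open>The minimal stationary process\<close>

lemma driving_prob_space: "driving_processes M lam A D \<Longrightarrow> prob_space M"
  by (simp add: driving_processes_def)

text \<open>The tail bound is uniform in starting time and number of steps, so Fatou's lemma carries
  it to the limit from the past. Uniformity in \<open>s\<close> lets the constants be chosen before
  the time.\<close>

lemma stationary_tail:
  fixes M :: "'w measure" and a :: "int ^ 'd \<Rightarrow> real"
  assumes a: "interference_sequence a" and lam: "0 < lam" "lam < 1 / infsum a UNIV"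
    and driving: "driving_processes M lam A D"
    and X: "minimal_stationary_process M a A D X"
  obtains C \<theta> where "0 < \<theta>"
    "\<And>i s n. 1 \<le> n \<Longrightarrow> measure M {\<omega> \<in> space M. enat n \<le> X i s \<omega>} \<le> C * exp (- \<theta> * real n)"
proof -
  interpret prob_space M using driving by (rule driving_prob_space)
  from X obtain Y :: "real \<Rightarrow> int ^ 'd \<Rightarrow> real \<Rightarrow> 'w \<Rightarrow> nat" where
    "\<forall>t\<ge>0. \<forall>i. \<forall>s\<ge>-t. Y t i s \<in> measurable M (count_space UNIV)"
    "\<forall>t\<ge>0. AE \<omega> in M. queue_path_from_empty a (\<lambda>i. A i \<omega>) (\<lambda>i. D i \<omega>) (- t) (\<lambda>i s. Y t i s \<omega>)"
    "\<forall>i s. X i s \<in> measurable M (count_space UNIV)"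
    "\<forall>i s. AE \<omega> in M. ((\<lambda>t. enat (Y t i s \<omega>)) \<longlongrightarrow> X i s \<omega>) at_top"
    unfolding minimal_stationary_process_def by (elim exE conjE) (rule that)
  then have Ym: "\<And>t i s. 0 \<le> t \<Longrightarrow> - t \<le> s \<Longrightarrow> Y t i s \<in> measurable M (count_space UNIV)"
    and Yp: "\<And>t. 0 \<le> t \<Longrightarrow> AE \<omega> in M.
      queue_path_from_empty a (\<lambda>i. A i \<omega>) (\<lambda>i. D i \<omega>) (- t) (\<lambda>i s. Y t i s \<omega>)"
    and Xm: "\<And>i s. X i s \<in> measurable M (count_space UNIV)"
    and lim: "\<And>i s. AE \<omega> in M. ((\<lambda>t. enat (Y t i s \<omega>)) \<longlongrightarrow> X i s \<omega>) at_top"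
    by blast+
  have \<alpha>: "1 \<le> infsum a UNIV" by (rule interference_sequence_sum[OF a])
  then have "lam * infsum a UNIV < 1" using lam(2) by (simp add: pos_less_divide_eq)
  from ex_contraction_parameters[OF lam(1) \<alpha> this]
  obtain h \<theta> where hb: "0 < h" "h < 1" and \<theta>: "0 < \<theta>"
    and q: "0 \<le> 1 - (1 - exp (- \<theta>)) * (h - h\<^sup>2 / 2) / infsum a UNIV"
    "exp (lam * h * (exp \<theta> - 1)) * (1 - (1 - exp (- \<theta>)) * (h - h\<^sup>2 / 2) / infsum a UNIV) < 1" .
  define C where "C = moment_bound (infsum a UNIV) (lam * h) (h - h\<^sup>2 / 2) \<theta>"
  have "measure M {\<omega> \<in> space M. enat n \<le> X i s \<omega>} \<le> C * exp (- \<theta> * real n)" if n: "1 \<le> n" for i s n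
  proof -
    \<comment> \<open>Starting times are chosen so that \<open>s\<close> is a grid point, reached
      after \<open>K + K0\<close> steps of length \<open>h\<close>; the offset \<open>K0\<close>
      makes every \<open>T K\<close> nonnegative.\<close>
    define K0 where "K0 = nat \<lceil>\<bar>s\<bar> / h\<rceil>"
    define T where "T K = real (K + K0) * h - s" for K
    have K0: "\<bar>s\<bar> \<le> real K0 * h"
    proof -
      have "\<bar>s\<bar> / h \<le> real K0" unfolding K0_def by linarith
      then show ?thesis using hb by (simp add: pos_divide_le_eq)
    qed
    have T: "0 \<le> T K" "- T K \<le> s" for K
    proof -
      have "real K0 * h \<le> real (K + K0) * h" using hb by (intro mult_right_mono) auto
      then show "0 \<le> T K" using K0 unfolding T_def by simp
      have "0 \<le> real (K + K0) * h" using hb by simp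
      then show "- T K \<le> s" unfolding T_def by simp
    qed
    have [measurable]: "X i s \<in> measurable M (count_space UNIV)" by (rule Xm)
    have [measurable]: "Y (T K) i s \<in> measurable M (count_space UNIV)" for K
      using T by (intro Ym) auto
    have Y_le: "prob {\<omega> \<in> space M. n \<le> Y (T K) i s \<omega>} \<le> C * exp (- \<theta> * real n)" for K
    proof -
      interpret driven_queues M lam A D "- T K" h
        by unfold_locales (use driving lam hb in auto)
      have s: "- T K + real (K + K0) * h = s" by (simp add: T_def)
      show ?thesis
        using queue_length_tail[OF a less_imp_le[OF hb(2)] \<theta> q Yp[OF T(1)] n, where i = i and K = "K + K0"]
        unfolding s C_def .
    qed
    have T_top: "filterlim T at_top sequentially"
    proof -
      have "filterlim (\<lambda>K. real K * h) at_top sequentially"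
        using hb by (intro filterlim_at_top_mult_tendsto_pos[OF tendsto_const _ filterlim_real_sequentially]) auto
      then have "filterlim (\<lambda>K. (real K0 * h - s) + real K * h) at_top sequentially"
        by (rule filterlim_tendsto_add_at_top[OF tendsto_const])
      then show ?thesis unfolding T_def by (simp add: algebra_simps)
    qed
    have ind: "AE \<omega> in M. (indicator {\<omega> \<in> space M. enat n \<le> X i s \<omega>} \<omega> :: ennreal)
        \<le> liminf (\<lambda>K. indicator {\<omega> \<in> space M. n \<le> Y (T K) i s \<omega>} \<omega>)"
      using lim[of i s] AE_space
    proof eventually_elim
      case (elim \<omega>)
      show ?case
      proof (cases "enat n \<le> X i s \<omega>")
        case True
        \<comment> \<open>Convergence yields only strict inequalities eventually; passing to
          \<open>n - 1\<close>, which needs \<open>n\<close> at least 1, loses nothing for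
          integers.\<close>
        then have "enat (n - 1) < X i s \<omega>" using n by (cases "X i s \<omega>") auto
        moreover have "(\<lambda>K. enat (Y (T K) i s \<omega>)) \<longlonglongrightarrow> X i s \<omega>"
          by (rule filterlim_compose[OF elim(1) T_top])
        ultimately have "eventually (\<lambda>K. enat (n - 1) < enat (Y (T K) i s \<omega>)) sequentially"
          by (rule order_tendstoD(1)[rotated])
        then have "eventually (\<lambda>K. (1::ennreal) \<le> indicator {\<omega> \<in> space M. n \<le> Y (T K) i s \<omega>} \<omega>) sequentially"
          by (rule eventually_mono) (use elim n in auto)
        then have "(1::ennreal) \<le> liminf (\<lambda>K. indicator {\<omega> \<in> space M. n \<le> Y (T K) i s \<omega>} \<omega>)"
          by (rule Liminf_bounded)
        then show ?thesis using True elim by simp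
      qed simp
    qed
    have "emeasure M {\<omega> \<in> space M. enat n \<le> X i s \<omega>}
        = (\<integral>\<^sup>+\<omega>. indicator {\<omega> \<in> space M. enat n \<le> X i s \<omega>} \<omega> \<partial>M)"
      by (rule nn_integral_indicator[symmetric]) measurable
    also have "\<dots> \<le> (\<integral>\<^sup>+\<omega>. liminf (\<lambda>K. indicator {\<omega> \<in> space M. n \<le> Y (T K) i s \<omega>} \<omega>) \<partial>M)"
      by (rule nn_integral_mono_AE[OF ind])
    also have "\<dots> \<le> liminf (\<lambda>K. \<integral>\<^sup>+\<omega>. indicator {\<omega> \<in> space M. n \<le> Y (T K) i s \<omega>} \<omega> \<partial>M)"
      by (rule nn_integral_liminf) measurable
    also have "\<dots> = liminf (\<lambda>K. ennreal (prob {\<omega> \<in> space M. n \<le> Y (T K) i s \<omega>}))"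
      by (simp add: emeasure_eq_measure)
    also have "\<dots> \<le> liminf (\<lambda>K. ennreal (C * exp (- \<theta> * real n)))"
      using Y_le by (intro Liminf_mono always_eventually allI ennreal_leI)
    also have "\<dots> = ennreal (C * exp (- \<theta> * real n))" by (simp add: Liminf_const)
    finally have "ennreal (prob {\<omega> \<in> space M. enat n \<le> X i s \<omega>}) \<le> ennreal (C * exp (- \<theta> * real n))"
      by (simp add: emeasure_eq_measure)
    moreover have "0 \<le> C * exp (- \<theta> * real n)" by (rule order_trans[OF measure_nonneg Y_le[of 0]])
    ultimately show ?thesis by (simp add: ennreal_le_iff)
  qed
  then show ?thesis using that[OF \<theta>] by blast
qed

text \<open>A burst in the window of length k / lam ending at \<open>s\<close> forces
  \<open>k\<close> customers in every path started before the window. Since the window does not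
  depend on the starting time, this survives the limit.\<close>

lemma stationary_all_small:
  fixes M :: "'w measure" and a :: "int ^ 'd \<Rightarrow> real"
  assumes a: "interference_sequence a" and lam: "0 < lam"
    and driving: "driving_processes M lam A D"
    and X: "minimal_stationary_process M a A D X"
    and k: "1 \<le> k" and J: "finite J"
  shows "measure M {\<omega> \<in> space M. \<forall>i\<in>J. X i s \<omega> < enat k}
    \<le> exp (- (real (card J) * exp (- (real k * (1 + 1 / lam)))))"
proof -
  interpret prob_space M using driving by (rule driving_prob_space)
  from X obtain Y :: "real \<Rightarrow> int ^ 'd \<Rightarrow> real \<Rightarrow> 'w \<Rightarrow> nat" where
    "\<forall>t\<ge>0. \<forall>i. \<forall>s\<ge>-t. Y t i s \<in> measurable M (count_space UNIV)"
    "\<forall>t\<ge>0. AE \<omega> in M. queue_path_from_empty a (\<lambda>i. A i \<omega>) (\<lambda>i. D i \<omega>) (- t) (\<lambda>i s. Y t i s \<omega>)"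
    "\<forall>i s. X i s \<in> measurable M (count_space UNIV)"
    "\<forall>i s. AE \<omega> in M. ((\<lambda>t. enat (Y t i s \<omega>)) \<longlongrightarrow> X i s \<omega>) at_top"
    unfolding minimal_stationary_process_def by (elim exE conjE) (rule that)
  then have Yp: "\<And>t. 0 \<le> t \<Longrightarrow> AE \<omega> in M.
      queue_path_from_empty a (\<lambda>i. A i \<omega>) (\<lambda>i. D i \<omega>) (- t) (\<lambda>i s. Y t i s \<omega>)"
    and Xm: "\<And>i s. X i s \<in> measurable M (count_space UNIV)"
    and lim: "\<And>i s. AE \<omega> in M. ((\<lambda>t. enat (Y t i s \<omega>)) \<longlongrightarrow> X i s \<omega>) at_top"
    by blast+
  define h where "h = real k / lam"
  have hb: "0 < h" "lam * h = real k" using lam k by (auto simp: h_def)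
  interpret driven_queues M lam A D "s - h" h
    by unfold_locales (use driving lam hb in auto)
  \<comment> \<open>A sequence of starting times, because the path equation holds outside a null set
    depending on the start and only countably many of these can be joined.\<close>
  define T where "T K = (\<bar>s\<bar> + h) + real K" for K :: nat
  have T: "0 \<le> T K" "- T K \<le> s - h" for K using hb by (auto simp: T_def)
  have T_top: "filterlim T at_top sequentially"
    unfolding T_def
    by (rule filterlim_tendsto_add_at_top[OF tendsto_const filterlim_real_sequentially])
  have paths: "AE \<omega> in M. \<forall>K. queue_path_from_empty a (\<lambda>i. A i \<omega>) (\<lambda>i. D i \<omega>) (- T K) (\<lambda>i s. Y (T K) i s \<omega>)"
    unfolding AE_all_countable using Yp[OF T(1)] by blast
  have lims: "AE \<omega> in M. \<forall>i. ((\<lambda>t. enat (Y t i s \<omega>)) \<longlongrightarrow> X i s \<omega>) at_top"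
    unfolding AE_all_countable using lim by blast
  have "AE \<omega> in M. (\<forall>i\<in>J. X i s \<omega> < enat k) \<longrightarrow> (\<forall>i\<in>J. \<not> (N 0 i \<omega> = k \<and> 1 < U 0 i \<omega>))"
    using paths lims AE_space
  proof (eventually_elim, intro impI ballI notI)
    fix \<omega> i
    assume p: "\<forall>K. queue_path_from_empty a (\<lambda>i. A i \<omega>) (\<lambda>i. D i \<omega>) (- T K) (\<lambda>i s. Y (T K) i s \<omega>)"
      and l: "\<forall>i. ((\<lambda>t. enat (Y t i s \<omega>)) \<longlongrightarrow> X i s \<omega>) at_top" and \<omega>: "\<omega> \<in> space M"
      and small: "\<forall>i\<in>J. X i s \<omega> < enat k" and i: "i \<in> J" and b: "N 0 i \<omega> = k \<and> 1 < U 0 i \<omega>"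
    have "k \<le> Y (T K) i s \<omega>" for K
      using burst_queue_length[OF a \<omega> spec[OF p, of K] T(2)[of K], of i k] b by simp
    moreover have "(\<lambda>K. enat (Y (T K) i s \<omega>)) \<longlonglongrightarrow> X i s \<omega>"
      by (rule filterlim_compose[OF spec[OF l] T_top])
    ultimately have "enat k \<le> X i s \<omega>"
      by (intro LIMSEQ_le_const[of "\<lambda>K. enat (Y (T K) i s \<omega>)"]) auto
    then show False using small i by (auto simp: not_less[symmetric])
  qed
  then have "prob {\<omega> \<in> space M. \<forall>i\<in>J. X i s \<omega> < enat k}
      \<le> prob {\<omega> \<in> space M. \<forall>i\<in>J. \<not> (N 0 i \<omega> = k \<and> 1 < U 0 i \<omega>)}"
  proof (intro finite_measure_mono_AE)
    have [measurable]: "N 0 i \<in> measurable M (count_space UNIV)" "U 0 i \<in> borel_measurable M" for i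
      using N_poisson[of 0 i, THEN poisson_variable.N_measurable] U_measurable by auto
    show "{\<omega> \<in> space M. \<forall>i\<in>J. \<not> (N 0 i \<omega> = k \<and> 1 < U 0 i \<omega>)} \<in> events"
      using J by measurable
  qed (auto elim!: eventually_mono)
  also have "\<dots> \<le> exp (- (real (card J) * exp (- (real k + h))))"
    by (rule prob_no_burst[OF hb(2) J])
  also have "real k + h = real k * (1 + 1 / lam)" by (simp add: h_def distrib_left)
  finally show ?thesis .
qed

section \<open>Maxima over boxes\<close>

lemma card_linf_ball:
  "finite {i :: int ^ 'd. linf_norm i \<le> int N}"
  "card {i :: int ^ 'd. linf_norm i \<le> int N} = (2 * N + 1) ^ CARD('d)"
proof -
  let ?J = "{i :: int ^ 'd. linf_norm i \<le> int N}" and ?P = "PiE (UNIV :: 'd set) (\<lambda>_. {- int N..int N})"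
  have J: "i \<in> ?J \<longleftrightarrow> (\<forall>k. \<bar>i $ k\<bar> \<le> int N)" for i :: "int ^ 'd"
    unfolding linf_norm_def by (subst mem_Collect_eq, subst Max_le_iff) auto
  have "bij_betw vec_nth ?J ?P"
  proof (rule bij_betwI[where g = vec_lambda])
    show "vec_nth \<in> ?J \<rightarrow> ?P" using J by (auto simp: abs_le_iff minus_le_iff)
    show "vec_lambda \<in> ?P \<rightarrow> ?J" unfolding Pi_iff J by (auto simp: abs_le_iff minus_le_iff PiE_iff)
  qed auto
  moreover have "finite ?P" by (intro finite_PiE) auto
  moreover have "card ?P = (2 * N + 1) ^ CARD('d)"
  proof -
    have "nat (1 + int N + int N) = 2 * N + 1" by simp
    then show ?thesis by (simp add: card_PiE)
  qed
  ultimately show "finite ?J" "card ?J = (2 * N + 1) ^ CARD('d)"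
    using bij_betw_finite bij_betw_same_card by metis+
qed

lemma ereal_of_enat_Max_ge_iff:
  assumes "finite S" "S \<noteq> {}"
  shows "c \<le> ereal_of_enat (Max S) \<longleftrightarrow> (\<exists>x\<in>S. c \<le> ereal_of_enat x)"
    and "ereal_of_enat (Max S) \<le> c \<longleftrightarrow> (\<forall>x\<in>S. ereal_of_enat x \<le> c)"
proof -
  have "ereal_of_enat x \<le> ereal_of_enat (Max S)" if "x \<in> S" for x
    using that assms by simp
  moreover have "Max S \<in> S" using assms by simp
  ultimately show "c \<le> ereal_of_enat (Max S) \<longleftrightarrow> (\<exists>x\<in>S. c \<le> ereal_of_enat x)"
    "ereal_of_enat (Max S) \<le> c \<longleftrightarrow> (\<forall>x\<in>S. ereal_of_enat x \<le> c)"
    by (meson order_trans)+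
qed

theorem corollary2p2:
  fixes M :: "'w measure"
    and a :: "int ^ 'd \<Rightarrow> real"
    and lam :: real
    and A :: "int ^ 'd \<Rightarrow> 'w \<Rightarrow> real set"
    and D :: "int ^ 'd \<Rightarrow> 'w \<Rightarrow> (real \<times> real) set"
    and X :: "int ^ 'd \<Rightarrow> real \<Rightarrow> 'w \<Rightarrow> enat"
  assumes "interference_sequence a"
    and "0 < lam" and "lam < 1 / (\<Sum>\<^sub>\<infinity>j. a j)"
    and "driving_processes M lam A D"
    and "minimal_stationary_process M a A D X"
  shows "\<exists>C1>0. \<exists>C2>0. \<forall>t::real.
    (\<lambda>N::nat. measure M {\<omega> \<in> space M.
        ereal (C1 * ln (real N)) \<le> ereal_of_enat (MAX i\<in>{i. linf_norm i \<le> int N}. X i t \<omega>) \<and>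
        ereal_of_enat (MAX i\<in>{i. linf_norm i \<le> int N}. X i t \<omega>) \<le> ereal (C2 * ln (real N))})
      \<longlonglongrightarrow> 1"
proof -
  interpret prob_space M using assms(4) by (rule driving_prob_space)
  obtain C \<theta> where \<theta>: "0 < \<theta>" and tail:
    "\<And>i s n. 1 \<le> n \<Longrightarrow> prob {\<omega> \<in> space M. enat n \<le> X i s \<omega>} \<le> C * exp (- \<theta> * real n)"
    using stationary_tail[OF assms] by metis
  have C: "0 \<le> C"
  proof -
    have "0 \<le> C * exp (- \<theta> * real 1)" using order_trans[OF measure_nonneg tail[of 1]] by simp
    then show ?thesis by (simp add: zero_le_mult_iff)
  qed
  let ?d = "CARD('d)"
  define c where "c = 1 + 1 / lam"
  \<comment> \<open>With k close to C1 * ln N, a burst has probability of order N powr (- 1 / 2),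
    while the box has at least \<open>N\<close> sites; the expected number of bursts grows like sqrt
    N.\<close>
  define C1 where "C1 = 1 / (2 * c)"
  \<comment> \<open>At level C2 * ln N a single tail is of order 1 / N ^ (d + 1), against at most (3
    * N) ^ d sites; the union bound leaves a multiple of 1 / N.\<close>
  define C2 where "C2 = (real ?d + 1) / \<theta>"
  have c: "0 < c" using assms(2) by (simp add: c_def add_pos_pos)
  have C1: "0 < C1" and C2: "0 < C2" using c \<theta> by (auto simp: C1_def C2_def)
  define J where "J N = {i :: int ^ 'd. linf_norm i \<le> int N}" for N
  have finJ: "finite (J N)" and cardJ: "card (J N) = (2 * N + 1) ^ ?d" for N
    unfolding J_def by (rule card_linf_ball)+
  have J_ne: "J N \<noteq> {}" for N using cardJ[of N] by (auto simp del: power_Suc)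
  have X_m: "X i t \<in> measurable M (count_space UNIV)" for i t
    using assms(5) unfolding minimal_stationary_process_def by blast
  have X_event: "{\<omega> \<in> space M. P (X i t \<omega>)} \<in> events" for P i t
  proof -
    note [measurable] = X_m[of i t]
    show ?thesis by measurable
  qed
  define e1 where "e1 N = exp (- (real N * exp (- ((C1 * ln (real N) + 1) * c))))" for N :: nat
  define e2 where "e2 N = C * 3 ^ ?d / real N" for N :: nat
  have "(\<lambda>N. prob {\<omega> \<in> space M.
        ereal (C1 * ln (real N)) \<le> ereal_of_enat (MAX i\<in>J N. X i t \<omega>) \<and>
        ereal_of_enat (MAX i\<in>J N. X i t \<omega>) \<le> ereal (C2 * ln (real N))}) \<longlonglongrightarrow> 1" for t
  proof -
    let ?low = "\<lambda>N \<omega>. ereal (C1 * ln (real N)) \<le> ereal_of_enat (MAX i\<in>J N. X i t \<omega>)"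
    let ?upp = "\<lambda>N \<omega>. ereal_of_enat (MAX i\<in>J N. X i t \<omega>) \<le> ereal (C2 * ln (real N))"
    have low_iff: "?low N \<omega> \<longleftrightarrow> (\<exists>i\<in>J N. ereal (C1 * ln (real N)) \<le> ereal_of_enat (X i t \<omega>))" for N \<omega>
      using ereal_of_enat_Max_ge_iff(1)[of "(\<lambda>i. X i t \<omega>) ` J N"] finJ J_ne by simp
    have upp_iff: "?upp N \<omega> \<longleftrightarrow> (\<forall>i\<in>J N. ereal_of_enat (X i t \<omega>) \<le> ereal (C2 * ln (real N)))" for N \<omega>
      using ereal_of_enat_Max_ge_iff(2)[of "(\<lambda>i. X i t \<omega>) ` J N"] finJ J_ne by simp
    have low_event: "{\<omega> \<in> space M. ?low N \<omega>} \<in> events" for N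
      unfolding low_iff using finJ X_event by (intro sets.sets_Collect_finite_Ex) auto
    have upp_event: "{\<omega> \<in> space M. ?upp N \<omega>} \<in> events" for N
      unfolding upp_iff using finJ X_event by (intro sets.sets_Collect_finite_All) auto
    have lower: "prob {\<omega> \<in> space M. \<not> ?low N \<omega>} \<le> e1 N" if N: "2 \<le> N" for N
    proof -
      have ln: "0 < ln (real N)" using N by simp
      \<comment> \<open>Rounding up costs at most 1, which is the additional 1 in \<open>e1\<close>;
        \<open>N\<close> at least 2 makes the level positive and \<open>k\<close> nonzero.\<close>
      define k where "k = nat \<lceil>C1 * ln (real N)\<rceil>"
      have pos: "0 < C1 * ln (real N)" using C1 ln by simp
      have k: "1 \<le> k" "C1 * ln (real N) \<le> real k" "real k \<le> C1 * ln (real N) + 1"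
        using pos unfolding k_def by linarith+
      have "prob {\<omega> \<in> space M. \<not> ?low N \<omega>} \<le> prob {\<omega> \<in> space M. \<forall>i\<in>J N. X i t \<omega> < enat k}"
      proof (rule finite_measure_mono)
        show "{\<omega> \<in> space M. \<not> ?low N \<omega>} \<subseteq> {\<omega> \<in> space M. \<forall>i\<in>J N. X i t \<omega> < enat k}"
        proof (intro subsetI CollectI conjI ballI)
          fix \<omega> i assume \<omega>: "\<omega> \<in> {\<omega> \<in> space M. \<not> ?low N \<omega>}" and i: "i \<in> J N"
          show "X i t \<omega> < enat k"
          proof (rule ccontr)
            assume "\<not> X i t \<omega> < enat k"
            then have "ereal_of_enat (enat k) \<le> ereal_of_enat (X i t \<omega>)"
              by (simp only: ereal_of_enat_le_iff not_less)
            moreover have "ereal (C1 * ln (real N)) \<le> ereal_of_enat (enat k)" using k by simp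
            ultimately have "?low N \<omega>" unfolding low_iff using i by (meson order_trans)
            then show False using \<omega> by simp
          qed
        qed auto
        show "{\<omega> \<in> space M. \<forall>i\<in>J N. X i t \<omega> < enat k} \<in> events"
          using finJ X_event by (intro sets.sets_Collect_finite_All) auto
      qed
      also have "\<dots> \<le> exp (- (real (card (J N)) * exp (- (real k * c))))"
        unfolding c_def by (rule stationary_all_small[OF assms(1,2,4,5) k(1) finJ])
      also have "\<dots> \<le> e1 N"
      proof -
        have "real N \<le> real (card (J N))"
        proof -
          have "2 * N + 1 \<le> (2 * N + 1) ^ ?d" by (rule self_le_power) auto
          then show ?thesis unfolding cardJ by linarith
        qed
        moreover have "exp (- ((C1 * ln (real N) + 1) * c)) \<le> exp (- (real k * c))"
          using k(3) c by simp
        ultimately show ?thesis unfolding e1_def by (simp add: mult_mono)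
      qed
      finally show ?thesis .
    qed
    have upper: "prob {\<omega> \<in> space M. \<not> ?upp N \<omega>} \<le> e2 N" if N: "2 \<le> N" for N
    proof -
      have pos: "0 < C2 * ln (real N)" using C2 N by simp
      \<comment> \<open>The least natural number above C2 * ln N, so a queue violates the upper
        bound only if its length is at least \<open>n\<close>.\<close>
      define n where "n = nat \<lfloor>C2 * ln (real N)\<rfloor> + 1"
      have n: "1 \<le> n" "C2 * ln (real N) \<le> real n" "\<And>m. m < n \<Longrightarrow> real m \<le> C2 * ln (real N)"
        using pos unfolding n_def by linarith+
      have "prob {\<omega> \<in> space M. \<not> ?upp N \<omega>} \<le> prob (\<Union>i\<in>J N. {\<omega> \<in> space M. enat n \<le> X i t \<omega>})"
      proof (rule finite_measure_mono)
        show "{\<omega> \<in> space M. \<not> ?upp N \<omega>} \<subseteq> (\<Union>i\<in>J N. {\<omega> \<in> space M. enat n \<le> X i t \<omega>})"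
        proof
          fix \<omega> assume "\<omega> \<in> {\<omega> \<in> space M. \<not> ?upp N \<omega>}"
          then obtain i where \<omega>: "\<omega> \<in> space M" and i: "i \<in> J N"
            and x: "\<not> ereal_of_enat (X i t \<omega>) \<le> ereal (C2 * ln (real N))"
            unfolding upp_iff by auto
          have "enat n \<le> X i t \<omega>"
          \<comment> \<open>An infinite value belongs to the tail event as well and is covered by
            the same estimate.\<close>
          proof (cases "X i t \<omega>")
            case (enat m)
            then show ?thesis using x n(3)[of m] by (auto simp: not_less[symmetric])
          qed simp
          then show "\<omega> \<in> (\<Union>i\<in>J N. {\<omega> \<in> space M. enat n \<le> X i t \<omega>})" using \<omega> i by auto
        qed
        show "(\<Union>i\<in>J N. {\<omega> \<in> space M. enat n \<le> X i t \<omega>}) \<in> events"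
          using finJ X_event by (intro sets.finite_UN) auto
      qed
      also have "\<dots> \<le> (\<Sum>i\<in>J N. prob {\<omega> \<in> space M. enat n \<le> X i t \<omega>})"
        using finJ X_event by (intro finite_measure_subadditive_finite) auto
      also have "\<dots> \<le> (\<Sum>i\<in>J N. C * exp (- \<theta> * real n))"
        by (intro sum_mono tail n(1))
      also have "\<dots> = C * (real (2 * N + 1) ^ ?d * exp (- \<theta> * real n))"
        by (simp add: cardJ)
      also have "\<dots> \<le> C * ((3 * real N) ^ ?d * (1 / real N ^ (?d + 1)))"
      proof (intro mult_left_mono[OF _ C] mult_mono power_mono)
        have "exp (- \<theta> * real n) \<le> exp (- \<theta> * (C2 * ln (real N)))" using \<theta> n(2) by simp
        also have "- \<theta> * (C2 * ln (real N)) = - (real (?d + 1) * ln (real N))"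
          using \<theta> by (simp add: C2_def)
        also have "exp \<dots> = 1 / real N ^ (?d + 1)"
          using N by (simp only: exp_minus exp_of_nat_mult) (simp add: divide_inverse)
        finally show "exp (- \<theta> * real n) \<le> 1 / real N ^ (?d + 1)" .
      qed (use N in auto)
      also have "\<dots> = e2 N"
        using N by (simp add: e2_def power_mult_distrib)
      finally show ?thesis .
    qed
    have "1 - (e1 N + e2 N) \<le> prob {\<omega> \<in> space M. ?low N \<omega> \<and> ?upp N \<omega>}" if N: "2 \<le> N" for N
    proof -
      have ev: "{\<omega> \<in> space M. ?low N \<omega> \<and> ?upp N \<omega>} \<in> events"
        using sets.Int[OF low_event[of N] upp_event[of N]] by (simp add: Int_def conj_ac cong: conj_cong)
      have nl: "{\<omega> \<in> space M. \<not> ?low N \<omega>} \<in> events" "{\<omega> \<in> space M. \<not> ?upp N \<omega>} \<in> events"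
        using low_event upp_event by (auto intro: sets.sets_Collect_neg)
      have "1 - prob {\<omega> \<in> space M. ?low N \<omega> \<and> ?upp N \<omega>}
          = prob (space M - {\<omega> \<in> space M. ?low N \<omega> \<and> ?upp N \<omega>})"
        by (rule prob_compl[OF ev, symmetric])
      also have "\<dots> = prob ({\<omega> \<in> space M. \<not> ?low N \<omega>} \<union> {\<omega> \<in> space M. \<not> ?upp N \<omega>})"
        by (rule arg_cong[where f=prob]) auto
      also have "\<dots> \<le> prob {\<omega> \<in> space M. \<not> ?low N \<omega>} + prob {\<omega> \<in> space M. \<not> ?upp N \<omega>}"
        using nl by (intro measure_Un_le)
      also have "\<dots> \<le> e1 N + e2 N" using lower[OF N] upper[OF N] by (rule add_mono)
      finally show ?thesis by simp
    qed
    then have ge: "eventually (\<lambda>N. 1 - (e1 N + e2 N) \<le> prob {\<omega> \<in> space M. ?low N \<omega> \<and> ?upp N \<omega>}) sequentially"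
      by (intro eventually_sequentiallyI[of 2]) auto
    have lim: "(\<lambda>N. 1 - (e1 N + e2 N)) \<longlonglongrightarrow> 1"
    proof -
      have "eventually (\<lambda>N. e1 N = exp (- (exp (- c) * sqrt (real N)))) sequentially"
      proof (intro eventually_sequentiallyI[of 1])
        fix N :: nat assume N: "1 \<le> N"
        have "(C1 * ln (real N) + 1) * c = ln (real N) / 2 + c"
          using c by (simp add: C1_def field_simps)
        then have "real N * exp (- ((C1 * ln (real N) + 1) * c)) = exp (ln (real N)) * exp (- (ln (real N) / 2) - c)"
          using N by simp
        also have "\<dots> = exp (- c) * exp (ln (real N) / 2)"
          by (simp add: exp_add[symmetric])
        also have "exp (ln (real N) / 2) = sqrt (real N)"
        proof -
          have l: "ln (sqrt (real N)) = ln (real N) / 2" using N by (intro ln_sqrt) simp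
          have "exp (ln (sqrt (real N))) = sqrt (real N)" using N by (intro exp_ln) simp
          then show ?thesis unfolding l .
        qed
        finally show "e1 N = exp (- (exp (- c) * sqrt (real N)))" by (simp add: e1_def)
      qed
      moreover have "(\<lambda>N. exp (- (exp (- c) * sqrt (real N)))) \<longlonglongrightarrow> 0"
      proof -
        have "filterlim (\<lambda>N. exp (- c) * sqrt (real N)) at_top sequentially"
          by (intro filterlim_tendsto_pos_mult_at_top[OF tendsto_const]
              filterlim_compose[OF sqrt_at_top filterlim_real_sequentially]) auto
        then show ?thesis
          by (intro filterlim_compose[OF exp_at_bot] filterlim_compose[OF filterlim_uminus_at_bot_at_top])
      qed
      ultimately have "e1 \<longlonglongrightarrow> 0" by (simp add: tendsto_cong)
      moreover have "e2 \<longlonglongrightarrow> 0" unfolding e2_def by (rule lim_const_over_n)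
      ultimately have "(\<lambda>N. 1 - (e1 N + e2 N)) \<longlonglongrightarrow> 1 - (0 + 0)" by (intro tendsto_intros)
      then show ?thesis by simp
    qed
    have le: "eventually (\<lambda>N. prob {\<omega> \<in> space M. ?low N \<omega> \<and> ?upp N \<omega>} \<le> 1) sequentially"
      by (intro always_eventually allI prob_le_1)
    show ?thesis by (rule tendsto_sandwich[OF ge le lim tendsto_const])
  qed
  then show ?thesis using C1 C2 unfolding J_def by blast
qed

end
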